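(* Let $u\in G[0,1]$, $\beta\in\mathbb R$, $\eta\in[0,1]$, and let $f,g:[0,1]\times\mathbb R\to\mathbb R$ satisfy the following assumptions. (H1) For every $x\in G[0,1]$ the function $t\mapsto f(t,x(t))$ is Kurzweil--Henstock integrable on $[0,1]$. (H2) For every $t\in[0,1]$ the function $f(t,\cdot)$ is continuous on $\mathbb R$. (H3') There exists a nonnegative Kurzweil--Henstock integrable function $h:[0,1]\to\mathbb R$ such that for every $r>0$, every $x\in B_r$ and every $t\in[0,1]$, $$-h(t)\le f(t,x(t))\le h(t).$$ (H4) For every $x\in G[0,1]$ the function $t\mapsto g(t,x(t))$ is of bounded variation on $[0,1]$, and $g(0,x(0))=0$. (H5) For every $t\in[0,1]$ the function $g(t,\cdot)$ is continuous on $\mathbb R$. (H6) There exists $M>0$ such that for every $r>0$ and every $x\in B_r$ the total variation on $[0,1]$ of $t\mapsto g(t,x(t))$ is at most $M$. Then the boundary value problem $$-D^2x=f(t,x)+g(t,x)Du\quad\text{on }[0,1],\qquad x(0)=\beta\,Dx(0),\qquad Dx(1)+Dx(\eta)=0,$$ has at least one solution $x\in G[0,1]$.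
   Context: $G[0,1]$ is the space of real regulated functions on $[0,1]$ (functions all of whose one-sided limits exist and are finite at every point of $[0,1]$), with the supremum norm $\|x\|=\sup_{t\in[0,1]}|x(t)|$. For $r>0$, $B_r=\{x\in G[0,1]:\|x\|\le r\}$. The total variation of $v:[0,1]\to\mathbb R$ is $\sup\sum_n|v(s_n)-v(t_n)|$ over all sequences $\{(t_n,s_n)\}$ of disjoint intervals in $[0,1]$. Kurzweil--Henstock--Stieltjes integral: for $v,u:[a,b]\to\mathbb R$, $\int_a^b v\,du=I$ means that for every $\varepsilon>0$ there is a function $\delta:[a,b]\to(0,\infty)$ such that $\left|\sum_{i=1}^m v(\xi_i)(u(t_i)-u(t_{i-1}))-I\right|<\varepsilon$ for every partition $a=t_0<t_1<\dots<t_m=b$ with tags $\xi_i\in[t_{i-1},t_i]$ satisfying $[t_{i-1},t_i]\subset(\xi_i-\delta(\xi_i),\xi_i+\delta(\xi_i))$ for all $i$. With $u(t)=t$ this is the Kurzweil--Henstock integral. The integral of a function of bounded variation against a regulated function exists in this sense. $D$ denotes the distributional derivative. The equation is understood in its once-integrated form. For $x\in G[0,1]$ put $F(t,x)=\int_0^t f(s,x(s))\,ds$ and $G_u(t,x)=\int_0^t g(s,x(s))\,du(s)$ for $t\in[0,1]$. A solution of the boundary value problem is a function $x\in G[0,1]$ for which there is a regulated function, denoted $Dx:[0,1]\to\mathbb R$, such that for all $t\in[0,1]$ $$x(t)=x(0)+\int_0^t Dx(s)\,ds,\qquad Dx(t)=Dx(0)-F(t,x)-G_u(t,x),$$ and such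 that $x(0)=\beta Dx(0)$ and $Dx(1)+Dx(\eta)=0$ hold with these pointwise values of $Dx$. *)

theory Defs
  imports "HOL-Analysis.Analysis"
begin

text \<open>
  Functions on a compact interval \<open>[a, b]\<close> are represented by total functions on the reals, of
  which only the values on \<open>[a, b]\<close> are ever used.
\<close>

definition regulated_on :: "real \<Rightarrow> real \<Rightarrow> (real \<Rightarrow> real) \<Rightarrow> bool" where
  "regulated_on a b x \<longleftrightarrow>
     (\<forall>t. a \<le> t \<and> t < b \<longrightarrow> (\<exists>l. (x \<longlongrightarrow> l) (at_right t))) \<and>
     (\<forall>t. a < t \<and> t \<le> b \<longrightarrow> (\<exists>l. (x \<longlongrightarrow> l) (at_left t)))"

definition G01 :: "(real \<Rightarrow> real) set" where
  "G01 = {x. regulated_on 0 1 x}"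

text \<open>Regulated functions are bounded, so the real supremum below is meaningful on \<^const>\<open>G01\<close>.\<close>

definition G01_norm :: "(real \<Rightarrow> real) \<Rightarrow> real" where
  "G01_norm x = (SUP t\<in>{0..1}. \<bar>x t\<bar>)"

definition G01_ball :: "real \<Rightarrow> (real \<Rightarrow> real) set" where
  "G01_ball r = {x \<in> G01. G01_norm x \<le> r}"

text \<open>
  The supremum ranges over all sequences of pairwise disjoint open intervals \<open>(t n, s n)\<close> with end
  points in \<open>[a, b]\<close>. Degenerate intervals, for which \<open>t n = s n\<close>, contribute nothing to the sum,
  so finite families are included.
\<close>

definition total_variation :: "real \<Rightarrow> real \<Rightarrow> (real \<Rightarrow> real) \<Rightarrow> ennreal" where
  "total_variation a b v =
     (SUP (t, s) \<in> {(t :: nat \<Rightarrow> real, s :: nat \<Rightarrow> real).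
          (\<forall>n. a \<le> t n \<and> t n \<le> s n \<and> s n \<le> b) \<and> disjoint_family (\<lambda>n. {t n<..<s n})}.
        \<Sum>n. ennreal \<bar>v (s n) - v (t n)\<bar>)"

definition has_bounded_variation :: "real \<Rightarrow> real \<Rightarrow> (real \<Rightarrow> real) \<Rightarrow> bool" where
  "has_bounded_variation a b v \<longleftrightarrow> total_variation a b v < \<infinity>"

text \<open>
  \<open>has_KHS_integral v u a b I\<close> says that the Kurzweil--Henstock--Stieltjes integral of \<open>v\<close> with
  respect to \<open>u\<close> over \<open>[a, b]\<close> exists and equals \<open>I\<close>. For the identity \<open>u\<close> this is the
  Kurzweil--Henstock integral, for which the library relation \<^const>\<open>has_integral\<close> is used. The
  number \<open>m\<close> of subintervals may be \<open>0\<close>, which happens exactly if \<open>a = b\<close>. The \<open>i\<close>-th subinterval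
  is \<open>[t i, t (Suc i)]\<close>, with tag \<open>\<xi> i\<close>, for \<open>i < m\<close>.
\<close>

definition has_KHS_integral ::
  "(real \<Rightarrow> real) \<Rightarrow> (real \<Rightarrow> real) \<Rightarrow> real \<Rightarrow> real \<Rightarrow> real \<Rightarrow> bool" where
  "has_KHS_integral v u a b I \<longleftrightarrow>
     (\<forall>\<epsilon>>0. \<exists>\<delta> :: real \<Rightarrow> real. (\<forall>s\<in>{a..b}. \<delta> s > 0) \<and>
        (\<forall>(m :: nat) (t :: nat \<Rightarrow> real) (\<xi> :: nat \<Rightarrow> real).
           t 0 = a \<and> t m = b \<and>
           (\<forall>i<m. t i < t (Suc i) \<and> \<xi> i \<in> {t i..t (Suc i)} \<and>
                  {t i..t (Suc i)} \<subseteq> {\<xi> i - \<delta> (\<xi> i)<..<\<xi> i + \<delta> (\<xi> i)}) \<longrightarrow>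
           \<bar>(\<Sum>i<m. v (\<xi> i) * (u (t (Suc i)) - u (t i))) - I\<bar> < \<epsilon>))"

text \<open>
  Solutions of \<open>- D\<^sup>2 x = f(t, x) + g(t, x) D u\<close>, \<open>x(0) = \<beta> Dx(0)\<close>, \<open>Dx(1) + Dx(\<eta>) = 0\<close>, in
  once-integrated form. Here \<open>F t\<close> is the integral of \<open>f(s, x(s))\<close> over \<open>[0, t]\<close> and \<open>Gu t\<close> that of
  \<open>g(s, x(s))\<close> with respect to \<open>u\<close>; both are required to exist. The integral of \<open>Dx\<close> exists
  because \<open>Dx\<close> is regulated.
\<close>

definition is_BVP_solution ::
  "(real \<Rightarrow> real \<Rightarrow> real) \<Rightarrow> (real \<Rightarrow> real \<Rightarrow> real) \<Rightarrow> (real \<Rightarrow> real) \<Rightarrow> real \<Rightarrow> real \<Rightarrow>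
   (real \<Rightarrow> real) \<Rightarrow> bool" where
  "is_BVP_solution f g u \<beta> \<eta> x \<longleftrightarrow>
     x \<in> G01 \<and>
     (\<exists>Dx\<in>G01. \<exists>F Gu :: real \<Rightarrow> real.
        (\<forall>t\<in>{0..1}. ((\<lambda>s. f s (x s)) has_integral F t) {0..t}) \<and>
        (\<forall>t\<in>{0..1}. has_KHS_integral (\<lambda>s. g s (x s)) u 0 t (Gu t)) \<and>
        (\<forall>t\<in>{0..1}. x t = x 0 + integral {0..t} Dx) \<and>
        (\<forall>t\<in>{0..1}. Dx t = Dx 0 - F t - Gu t) \<and>
        x 0 = \<beta> * Dx 0 \<and>
        Dx 1 + Dx \<eta> = 0)"

end

(*
  Write c - p(t) for Dx(t), where p(t) is the integral of f(s, x(s)) over [0, t] plus that of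
  g(s, x(s)) du(s). The condition Dx(1) + Dx(eta) = 0 gives c = (p(1) + p(eta)) / 2, and the
  solutions are the fixed points of

    (T x)(t) = beta * c + integral of (c - p) over [0, t].

  The integrable majorant of f and the variation bound for g make T x bounded and Lipschitz,
  uniformly in x. If x_n -> x pointwise on [0, 1], then T x_n -> T x pointwise: for the f-term by
  dominated convergence; for the g-term because u is a uniform limit of step functions, against
  which the Stieltjes integral is a finite combination of values of the integrand, and the error
  of this approximation is controlled by the total variation alone (summation by parts).

  The fixed point is found without Schauder's theorem. On functions that are constant on the
  intervals [i/n, (i+1)/n), T induces a continuous self-map of the Hilbert cube, which has a fixed
  point by Kuhn's combinatorial lemma. This is a fixed point of T up to an error O(1/n), and the
  theorem of Arzela and Ascoli yields an exact one as n grows.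
*)
theory Submission
  imports Defs "HOL-Complex_Analysis.Great_Picard"
begin

section \<open>A fixed point theorem for the Hilbert cube\<close>

lemma compact_hilbert_cube: "compact (UNIV \<rightarrow> {0..1} :: (nat \<Rightarrow> real) set)"
proof -
  have "compactin (product_topology (\<lambda>i::nat. euclidean :: real topology) UNIV) (PiE UNIV (\<lambda>_. {0..1}))"
    by (auto simp: compactin_PiE compactin_euclidean_iff)
  then show ?thesis
    by (simp add: euclidean_product_topology compactin_euclidean_iff PiE_UNIV_domain Pi_def)
qed

lemma tendsto_fun_iff:
  fixes X :: "nat \<Rightarrow> nat \<Rightarrow> real"
  shows "X \<longlonglongrightarrow> z \<longleftrightarrow> (\<forall>i. (\<lambda>k. X k i) \<longlonglongrightarrow> z i)"
  unfolding limitin_canonical_iff[symmetric] euclidean_product_topology[symmetric] limitin_componentwise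
  by simp

text \<open>One limit both refines the grid and raises the dimension: for each \<open>p\<close>,
  Kuhn's lemma is applied to the grid of mesh \<open>1/p\<close> in the first \<open>p\<close>
  coordinates, all others being 0. The cells found accumulate at some \<open>z\<close> by
  compactness, and each coordinate of \<open>\<Phi> z - z\<close> is a limit of nonnegative numbers
  and also a limit of nonpositive ones.\<close>

theorem hilbert_cube_fixpoint:
  fixes \<Phi> :: "(nat \<Rightarrow> real) \<Rightarrow> nat \<Rightarrow> real"
  assumes cont: "continuous_on (UNIV \<rightarrow> {0..1}) \<Phi>"
    and maps: "\<And>a. a \<in> UNIV \<rightarrow> {0..1} \<Longrightarrow> \<Phi> a \<in> UNIV \<rightarrow> {0..1}"
  shows "\<exists>z\<in>UNIV \<rightarrow> {0..1}. \<Phi> z = z"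
proof -
  let ?Q = "UNIV \<rightarrow> {0..1} :: (nat \<Rightarrow> real) set"
  \<comment> \<open>The truncation by \<open>min 1\<close> puts the point in the cube for every
    \<open>r\<close>, so no range condition on grid indices has to be carried along.\<close>
  define pt where "pt p r i = (if i < p then min 1 (real (r i) / real p) else 0)" for p i :: nat and r
  \<comment> \<open>For \<open>i < p\<close>, label 0 implies that \<open>\<Phi>\<close> does not
    decrease coordinate \<open>i\<close>, and label 1 that it does not increase it. The cases
    \<open>r i = p\<close> and \<open>r i = 0\<close> are the boundary conditions of Kuhn's lemma;
    they fit this reading because \<open>\<Phi>\<close> takes values in the cube.\<close>
  define label where "label p r i = (if r i = p \<or> (r i \<noteq> 0 \<and> \<Phi> (pt p r) i < pt p r i) then 1 else 0 :: nat)"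
    for p r and i :: nat
  define near where "near p q w \<longleftrightarrow> (\<forall>j<p. q j \<le> w j \<and> w j \<le> q j + 1)" for p :: nat and q w :: "nat \<Rightarrow> nat"
  have pt_cube: "pt p r \<in> ?Q" for p r
    by (auto simp: pt_def)
  have \<Phi>01: "0 \<le> \<Phi> (pt p r) i" "\<Phi> (pt p r) i \<le> 1" for p r i
    using maps[OF pt_cube, of p r] by (auto simp: Pi_iff)
  have "\<exists>q. \<forall>i<p.
          (\<exists>r s. (\<forall>j<p. q j \<le> r j \<and> r j \<le> q j + 1) \<and> (\<forall>j<p. q j \<le> s j \<and> s j \<le> q j + 1) \<and>
             label p r i = 0 \<and> label p s i = 1)" if "0 < p" for p
  proof (rule kuhn_lemma[of p p "label p"])
    fix q
    assume lab: "\<forall>i<p. \<exists>r s. (\<forall>j<p. q j \<le> r j \<and> r j \<le> q j + 1) \<and>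
                  (\<forall>j<p. q j \<le> s j \<and> s j \<le> q j + 1) \<and> label p r i \<noteq> label p s i"
    show ?thesis
    proof (rule exI[of _ q], intro allI impI conjI)
      fix i assume "i < p"
      obtain r s where rs: "\<forall>j<p. q j \<le> r j \<and> r j \<le> q j + 1" "\<forall>j<p. q j \<le> s j \<and> s j \<le> q j + 1"
        "label p r i \<noteq> label p s i" using lab \<open>i < p\<close> by blast
      then consider "label p r i = 0" "label p s i = 1" | "label p r i = 1" "label p s i = 0"
        by (auto simp: label_def split: if_splits)
      then show "\<exists>r s. (\<forall>j<p. q j \<le> r j \<and> r j \<le> q j + 1) \<and> (\<forall>j<p. q j \<le> s j \<and> s j \<le> q j + 1) \<and>
             label p r i = 0 \<and> label p s i = 1"
        using rs(1,2) by cases blast+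
    qed
  qed (use that in \<open>auto simp: label_def\<close>)
  then have "\<forall>p. \<exists>q. \<forall>i<p. (\<exists>r s. near p q r \<and> near p q s \<and> label p r i = 0 \<and> label p s i = 1)"
    unfolding near_def by (metis not_less_zero neq0_conv)
  then obtain q where q: "\<forall>p. \<forall>i<p. 
      (\<exists>r s. near p (q p) r \<and> near p (q p) s \<and> label p r i = 0 \<and> label p s i = 1)"
    using choice[of "\<lambda>p q. \<forall>i<p. (\<exists>r s. near p q r \<and> near p q s \<and> label p r i = 0 \<and> label p s i = 1)"]
    by blast
  then have "\<forall>p i. \<exists>r s. i < p \<longrightarrow> near p (q p) r \<and> near p (q p) s \<and> label p r i = 0 \<and> label p s i = 1"
    by blast
  then obtain r s where r: "\<And>p i. i < p \<Longrightarrow> near p (q p) (r p i)"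
    and s: "\<And>p i. i < p \<Longrightarrow> near p (q p) (s p i)"
    and lr: "\<And>p i. i < p \<Longrightarrow> label p (r p i) i = 0" and ls: "\<And>p i. i < p \<Longrightarrow> label p (s p i) i = 1"
    by metis
  obtain z \<sigma> where z: "z \<in> ?Q" and \<sigma>: "strict_mono \<sigma>" and lim: "((\<lambda>p. pt p (q p)) \<circ> \<sigma>) \<longlonglongrightarrow> z"
    using compact_imp_seq_compact[OF compact_hilbert_cube] pt_cube unfolding seq_compact_def
    by (metis (no_types, lifting))
  \<comment> \<open>Vertices of one cell differ by at most \<open>1/p\<close> in each of the first
    \<open>p\<close> coordinates. Hence the limit is \<open>z\<close> for any choice of vertices, in
    particular for those that Kuhn's lemma supplies separately for each coordinate
    \<open>i\<close>.\<close>
  have lim_near: "(\<lambda>k. pt (\<sigma> k) (r' (\<sigma> k) i)) \<longlonglongrightarrow> z"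
    if r': "\<And>p i. i < p \<Longrightarrow> near p (q p) (r' p i)" for r' i
    unfolding tendsto_fun_iff
  proof
    fix j
    have zj: "(\<lambda>k. pt (\<sigma> k) (q (\<sigma> k)) j) \<longlonglongrightarrow> z j"
      using lim unfolding tendsto_fun_iff by (simp add: o_def)
    have "(\<lambda>k. inverse (real (\<sigma> k))) \<longlonglongrightarrow> 0"
      using LIMSEQ_subseq_LIMSEQ[OF lim_inverse_n \<sigma>] by (simp add: o_def)
    moreover have "\<forall>\<^sub>F k in sequentially.
        norm (pt (\<sigma> k) (r' (\<sigma> k) i) j - pt (\<sigma> k) (q (\<sigma> k)) j) \<le> inverse (real (\<sigma> k))"
      using eventually_gt_at_top[of "max i j"]
    proof eventually_elim
      case (elim k)
      then have *: "i < \<sigma> k" "j < \<sigma> k" using seq_suble[OF \<sigma>, of k] by auto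
      have "real (q (\<sigma> k) j) \<le> real (r' (\<sigma> k) i j)" "real (r' (\<sigma> k) i j) \<le> real (q (\<sigma> k) j) + 1"
        using r'[OF *(1)] *(2) unfolding near_def by (metis of_nat_mono of_nat_add of_nat_1)+
      then have le: "real (q (\<sigma> k) j) / \<sigma> k \<le> real (r' (\<sigma> k) i j) / \<sigma> k"
        "real (r' (\<sigma> k) i j) / \<sigma> k \<le> real (q (\<sigma> k) j) / \<sigma> k + inverse (\<sigma> k)"
        using * by (simp_all add: field_simps)
      have "\<bar>min 1 X - min 1 Y\<bar> \<le> e" if "Y \<le> X" "X \<le> Y + e" for X Y e :: real
        using that by linarith
      from this[OF le] show ?case using *(2) by (simp add: pt_def)
    qed
    ultimately have "(\<lambda>k. pt (\<sigma> k) (r' (\<sigma> k) i) j - pt (\<sigma> k) (q (\<sigma> k)) j) \<longlonglongrightarrow> 0"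
      by (rule Lim_null_comparison[rotated])
    from tendsto_add[OF this zj] show "(\<lambda>k. pt (\<sigma> k) (r' (\<sigma> k) i) j) \<longlonglongrightarrow> z j"
      by simp
  qed
  have lim_r: "(\<lambda>k. pt (\<sigma> k) (r (\<sigma> k) i)) \<longlonglongrightarrow> z" for i
    by (rule lim_near, rule r)
  have lim_s: "(\<lambda>k. pt (\<sigma> k) (s (\<sigma> k) i)) \<longlonglongrightarrow> z" for i
    by (rule lim_near, rule s)
  have lim_\<Phi>: "(\<lambda>k. \<Phi> (pt (\<sigma> k) (w k)) i - pt (\<sigma> k) (w k) i) \<longlonglongrightarrow> \<Phi> z i - z i"
    if "(\<lambda>k. pt (\<sigma> k) (w k)) \<longlonglongrightarrow> z" for w i
  proof -
    have "(\<lambda>k. \<Phi> (pt (\<sigma> k) (w k))) \<longlonglongrightarrow> \<Phi> z"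
      using continuous_on_tendsto_compose[OF cont that z] pt_cube by simp
    then show ?thesis using that unfolding tendsto_fun_iff by (intro tendsto_diff) auto
  qed
  have "\<Phi> z i = z i" for i
  proof (rule antisym)
    have large: "\<forall>\<^sub>F k in sequentially. i < \<sigma> k"
      using eventually_gt_at_top[of i]
      by eventually_elim (meson \<sigma> less_le_trans seq_suble)
    have "0 \<le> \<Phi> z i - z i"
    proof (rule tendsto_lowerbound[OF lim_\<Phi>[OF lim_r]])
      show "\<forall>\<^sub>F k in sequentially. 0 \<le> \<Phi> (pt (\<sigma> k) (r (\<sigma> k) i)) i - pt (\<sigma> k) (r (\<sigma> k) i) i"
        using large
      proof eventually_elim
        case (elim k)
        show ?case using lr[OF elim] \<Phi>01(1)[of "\<sigma> k" "r (\<sigma> k) i" i] elim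
          by (auto simp: label_def pt_def split: if_splits)
      qed
    qed auto
    then show "z i \<le> \<Phi> z i" by simp
    have "\<Phi> z i - z i \<le> 0"
    proof (rule tendsto_upperbound[OF lim_\<Phi>[OF lim_s]])
      show "\<forall>\<^sub>F k in sequentially. \<Phi> (pt (\<sigma> k) (s (\<sigma> k) i)) i - pt (\<sigma> k) (s (\<sigma> k) i) i \<le> 0"
        using large
      proof eventually_elim
        case (elim k)
        show ?case using ls[OF elim] \<Phi>01(2)[of "\<sigma> k" "s (\<sigma> k) i" i] elim
          by (auto simp: label_def pt_def split: if_splits)
      qed
    qed auto
    then show "\<Phi> z i \<le> z i" by simp
  qed
  with z show ?thesis by blast
qed

section \<open>Step functions and regulated functions\<close>

text \<open>Step functions as the span of indicators of rays: facts linear in the function reduce to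
  a single jump by rule induction. Both kinds of rays are present so that differences yield
  half-open intervals and single points.\<close>

inductive_set step_functions :: "(real \<Rightarrow> real) set" where
  closed_ray: "indicator {c..} \<in> step_functions"
| open_ray: "indicator {c<..} \<in> step_functions"
| add: "s \<in> step_functions \<Longrightarrow> s' \<in> step_functions \<Longrightarrow> (\<lambda>t. s t + s' t) \<in> step_functions"
| scale: "s \<in> step_functions \<Longrightarrow> (\<lambda>t. k * s t) \<in> step_functions"

lemma step_diff:
  assumes "s \<in> step_functions" "s' \<in> step_functions"
  shows "(\<lambda>t. s t - s' t) \<in> step_functions"
  using step_functions.add[OF assms(1) step_functions.scale[OF assms(2), of "-1"]] by simp

section \<open>Algebra of regulated functions, and their basic examples\<close>

lemma G01_left_limit: "x \<in> G01 \<Longrightarrow> 0 < t \<Longrightarrow> t \<le> 1 \<Longrightarrow> \<exists>l. (x \<longlongrightarrow> l) (at_left t)"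
  and G01_right_limit: "x \<in> G01 \<Longrightarrow> 0 \<le> t \<Longrightarrow> t < 1 \<Longrightarrow> \<exists>l. (x \<longlongrightarrow> l) (at_right t)"
  unfolding G01_def regulated_on_def mem_Collect_eq by simp_all

text \<open>Reduces closure under an operation to a limit rule for an arbitrary filter, which serves
  left and right limits alike.\<close>

lemma G01_combine:
  assumes "x \<in> G01" "y \<in> G01"
    and "\<And>F a b. (x \<longlongrightarrow> a) F \<Longrightarrow> (y \<longlongrightarrow> b) F \<Longrightarrow> \<exists>c. (z \<longlongrightarrow> c) F"
  shows "z \<in> G01"
  using assms unfolding G01_def regulated_on_def mem_Collect_eq by meson

lemma G01_add: "x \<in> G01 \<Longrightarrow> y \<in> G01 \<Longrightarrow> (\<lambda>t. x t + y t) \<in> G01"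
  by (erule (1) G01_combine) (rule exI, erule (1) tendsto_add)

lemma G01_diff: "x \<in> G01 \<Longrightarrow> y \<in> G01 \<Longrightarrow> (\<lambda>t. x t - y t) \<in> G01"
  by (erule (1) G01_combine) (rule exI, erule (1) tendsto_diff)

lemma G01_mult: "x \<in> G01 \<Longrightarrow> y \<in> G01 \<Longrightarrow> (\<lambda>t. x t * y t) \<in> G01"
  by (erule (1) G01_combine) (rule exI, erule (1) tendsto_mult)

lemma G01_const: "(\<lambda>t. c) \<in> G01"
  unfolding G01_def regulated_on_def using tendsto_const by blast

lemma G01_continuous:
  assumes "continuous_on {0..1} x"
  shows "x \<in> G01"
  unfolding G01_def regulated_on_def
proof (clarify, intro conjI allI impI)
  fix t :: real assume t: "0 \<le> t \<and> t < 1"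
  have "(x \<longlongrightarrow> x t) (at t within {t..1})"
    using assms t unfolding continuous_on_def by (auto intro: tendsto_within_subset[where S = "{0..1}"])
  then show "\<exists>l. (x \<longlongrightarrow> l) (at_right t)" using t by (auto simp: at_within_Icc_at_right)
next
  fix t :: real assume t: "0 < t \<and> t \<le> 1"
  have "(x \<longlongrightarrow> x t) (at t within {0..t})"
    using assms t unfolding continuous_on_def by (auto intro: tendsto_within_subset[where S = "{0..1}"])
  then show "\<exists>l. (x \<longlongrightarrow> l) (at_left t)" using t by (auto simp: at_within_Icc_at_left)
qed

lemma indicator_ray_one_sided_limits:
  fixes c t :: real
  shows "((indicator {c..} :: real \<Rightarrow> real) \<longlongrightarrow> (if c \<le> t then 1 else 0)) (at_right t)"
    and "((indicator {c..} :: real \<Rightarrow> real) \<longlongrightarrow> (if c < t then 1 else 0)) (at_left t)"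
    and "((indicator {c<..} :: real \<Rightarrow> real) \<longlongrightarrow> (if c \<le> t then 1 else 0)) (at_right t)"
    and "((indicator {c<..} :: real \<Rightarrow> real) \<longlongrightarrow> (if c < t then 1 else 0)) (at_left t)"
proof -
  have r: "\<forall>\<^sub>F x in at_right t. t < x \<and> (t < c \<longrightarrow> x < c)"
    using eventually_at_right_less[of t] eventually_at_right_real[of t c]
    by (cases "t < c") (auto elim: eventually_mono)
  have l: "\<forall>\<^sub>F x in at_left t. x < t \<and> (c < t \<longrightarrow> c < x)"
    using eventually_at_left_real[of "t - 1" t] eventually_at_left_real[of c t]
    by (cases "c < t") (auto elim: eventually_mono)
  show "((indicator {c..} :: real \<Rightarrow> real) \<longlongrightarrow> (if c \<le> t then 1 else 0)) (at_right t)"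
    by (rule tendsto_eventually, use r in eventually_elim) (auto split: split_indicator)
  show "((indicator {c..} :: real \<Rightarrow> real) \<longlongrightarrow> (if c < t then 1 else 0)) (at_left t)"
    by (rule tendsto_eventually, use l in eventually_elim) (auto split: split_indicator)
  show "((indicator {c<..} :: real \<Rightarrow> real) \<longlongrightarrow> (if c \<le> t then 1 else 0)) (at_right t)"
    by (rule tendsto_eventually, use r in eventually_elim) (auto split: split_indicator)
  show "((indicator {c<..} :: real \<Rightarrow> real) \<longlongrightarrow> (if c < t then 1 else 0)) (at_left t)"
    by (rule tendsto_eventually, use l in eventually_elim) (auto split: split_indicator)
qed

lemma step_in_G01: "s \<in> step_functions \<Longrightarrow> s \<in> G01"
proof (induction rule: step_functions.induct)
  case (closed_ray c) then show ?case
    unfolding G01_def regulated_on_def using indicator_ray_one_sided_limits by blast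
next
  case (open_ray c) then show ?case
    unfolding G01_def regulated_on_def using indicator_ray_one_sided_limits by blast
next
  case (add s s') show ?case by (rule G01_add[OF add.IH])
next
  case (scale s k) show ?case by (rule G01_mult[OF G01_const scale.IH])
qed

section \<open>Step functions: integrability, boundedness, and uniform approximation of regulated
  functions\<close>

lemma interval_Int_borel_lmeasurable:
  fixes a b :: real
  assumes "A \<in> sets borel"
  shows "A \<inter> {a..b} \<in> lmeasurable"
  using fmeasurable_Int_fmeasurable[OF lmeasurable_interval(1)[of a b], of A] assms
  by (simp add: Int_commute)

lemma step_integrable: "s \<in> step_functions \<Longrightarrow> s integrable_on {a..b}"
proof (induction rule: step_functions.induct)
  case (closed_ray c)
  show ?case unfolding integrable_on_indicator by (rule interval_Int_borel_lmeasurable) simp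
next
  case (open_ray c)
  show ?case unfolding integrable_on_indicator by (rule interval_Int_borel_lmeasurable) simp
next
  case (add s s') show ?case by (rule integrable_add[OF add.IH])
next
  case (scale s k) show ?case by (rule integrable_on_mult_right[OF scale.IH])
qed

lemma step_bounded: "s \<in> step_functions \<Longrightarrow> \<exists>B. \<forall>t. \<bar>s t\<bar> \<le> B"
proof (induction rule: step_functions.induct)
  case (closed_ray c) then show ?case by (intro exI[of _ 1]) (auto split: split_indicator)
next
  case (open_ray c) then show ?case by (intro exI[of _ 1]) (auto split: split_indicator)
next
  case (add s s')
  then obtain B B' where "\<forall>t. \<bar>s t\<bar> \<le> B" "\<forall>t. \<bar>s' t\<bar> \<le> B'" by blast
  then show ?case by (intro exI[of _ "B + B'"]) (meson abs_triangle_ineq add_mono order_trans)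
next
  case (scale s k)
  then obtain B where "\<forall>t. \<bar>s t\<bar> \<le> B" by blast
  then show ?case by (intro exI[of _ "\<bar>k\<bar> * B"]) (simp add: abs_mult mult_left_mono)
qed

text \<open>Bisection: around any point, the one-sided limits and the value at the point itself give
  a step function with at most three values that works on all short intervals containing the
  point.\<close>

lemma regulated_step_approx:
  assumes u: "u \<in> G01" and e: "0 < \<epsilon>"
  shows "\<exists>s\<in>step_functions. \<forall>t\<in>{0..1}. \<bar>u t - s t\<bar> \<le> \<epsilon>"
proof -
  \<comment> \<open>On half-open intervals, with \<open>s\<close> vanishing outside, concatenation is addition.\<close>
  define P where "P a b \<longleftrightarrow> (0 \<le> a \<and> a \<le> b \<and> b \<le> 1 \<longrightarrow>
     (\<exists>s\<in>step_functions. (\<forall>t\<in>{a<..b}. \<bar>u t - s t\<bar> \<le> \<epsilon>) \<and> (\<forall>t. t \<notin> {a<..b} \<longrightarrow> s t = 0)))" for a b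
  have "P 0 1"
  proof (rule Bolzano)
    fix a b c assume *: "P a b" "P b c" "a \<le> b" "b \<le> c"
    show "P a c"
      unfolding P_def
    proof
      assume "0 \<le> a \<and> a \<le> c \<and> c \<le> 1"
      then have "0 \<le> a \<and> a \<le> b \<and> b \<le> 1" and bc: "0 \<le> b \<and> b \<le> c \<and> c \<le> 1"
        using *(3,4) by auto
      with *(1) obtain s where s: "s \<in> step_functions" "\<forall>t\<in>{a<..b}. \<bar>u t - s t\<bar> \<le> \<epsilon>" "\<forall>t. t \<notin> {a<..b} \<longrightarrow> s t = 0"
        unfolding P_def by blast
      from bc *(2) obtain s' where s': "s' \<in> step_functions" "\<forall>t\<in>{b<..c}. \<bar>u t - s' t\<bar> \<le> \<epsilon>" "\<forall>t. t \<notin> {b<..c} \<longrightarrow> s' t = 0"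
        unfolding P_def by blast
      have close: "\<bar>u t - (s t + s' t)\<bar> \<le> \<epsilon>" if "t \<in> {a<..c}" for t
        using s(2,3) s'(2,3) that by (cases "t \<le> b") auto
      have zero: "s t + s' t = 0" if "t \<notin> {a<..c}" for t
        using s(3) s'(3) that *(3,4) by auto
      show "\<exists>s\<in>step_functions. (\<forall>t\<in>{a<..c}. \<bar>u t - s t\<bar> \<le> \<epsilon>) \<and> (\<forall>t. t \<notin> {a<..c} \<longrightarrow> s t = 0)"
        by (rule bexI[OF _ step_functions.add[OF s(1) s'(1)]]) (intro conjI ballI allI impI close zero)
    qed
  next
    fix x :: real assume x: "0 \<le> x" "x \<le> 1"
    have "\<exists>l d. 0 < d \<and> (\<forall>t. x - d < t \<and> t < x \<longrightarrow> \<bar>u t - l\<bar> \<le> \<epsilon>)" if pos: "0 < x"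
    proof -
      obtain l where "(u \<longlongrightarrow> l) (at_left x)" using G01_left_limit[OF u pos x(2)] by blast
      then have "\<forall>\<^sub>F t in at_left x. dist (u t) l < \<epsilon>" using e by (rule tendstoD)
      then obtain b where "b < x" "\<forall>t. b < t \<and> t < x \<longrightarrow> dist (u t) l < \<epsilon>"
        unfolding eventually_at_left_field by blast
      then show ?thesis by (intro exI[of _ l] exI[of _ "x - b"]) (auto simp: dist_real_def less_imp_le)
    qed
    then obtain l dl where l: "0 < dl" "\<And>t. 0 < x \<Longrightarrow> x - dl < t \<Longrightarrow> t < x \<Longrightarrow> \<bar>u t - l\<bar> \<le> \<epsilon>"
      by (cases "0 < x") (auto intro: that[of 1])
    have "\<exists>r d. 0 < d \<and> (\<forall>t. x < t \<and> t < x + d \<longrightarrow> \<bar>u t - r\<bar> \<le> \<epsilon>)" if lt1: "x < 1"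
    proof -
      obtain r where "(u \<longlongrightarrow> r) (at_right x)" using G01_right_limit[OF u x(1) lt1] by blast
      then have "\<forall>\<^sub>F t in at_right x. dist (u t) r < \<epsilon>" using e by (rule tendstoD)
      then obtain b where "x < b" "\<forall>t. x < t \<and> t < b \<longrightarrow> dist (u t) r < \<epsilon>"
        unfolding eventually_at_right_field by blast
      then show ?thesis by (intro exI[of _ r] exI[of _ "b - x"]) (auto simp: dist_real_def less_imp_le)
    qed
    then obtain r dr where r: "0 < dr" "\<And>t. x < 1 \<Longrightarrow> x < t \<Longrightarrow> t < x + dr \<Longrightarrow> \<bar>u t - r\<bar> \<le> \<epsilon>"
      by (cases "x < 1") (auto intro: that[of 1])
    have "P a b" if ab: "a \<le> x" "x \<le> b" "b - a < min dl dr" for a b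
      unfolding P_def
    proof
      assume 01: "0 \<le> a \<and> a \<le> b \<and> b \<le> 1"
      \<comment> \<open>The values are \<open>l\<close> on \<open>(a, x)\<close>, \<open>u x\<close>
        at \<open>x\<close>, and \<open>r\<close> on \<open>(x, b]\<close>. If \<open>a = x\<close>,
        the point \<open>x\<close> is outside \<open>(a, b]\<close> and \<open>s\<close> must vanish
        there, hence the factor in front of the first two terms.\<close>
      define s where "s = (\<lambda>t. (if a < x then 1 else 0) *
          (l * (indicator {a<..} t - indicator {x..} t) + u x * (indicator {x..} t - indicator {x<..} t))
          + r * (indicator {x<..} t - indicator {b<..} t))"
      have "s \<in> step_functions"
        unfolding s_def by (intro step_functions.intros step_diff)
      moreover have "\<bar>u t - s t\<bar> \<le> \<epsilon>" if "t \<in> {a<..b}" for t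
      proof -
        consider "t < x" | "t = x" | "x < t" by linarith
        then show ?thesis
        proof cases
          case 1
          then have "s t = l" using that ab by (auto simp: s_def)
          then show ?thesis using l(2)[of t] 1 that ab 01 by auto
        next
          case 2
          then have "s t = u x" using that ab by (auto simp: s_def)
          then show ?thesis using 2 e by simp
        next
          case 3
          then have "s t = r" using that ab by (auto simp: s_def)
          then show ?thesis using r(2)[of t] 3 that ab 01 by auto
        qed
      qed
      moreover have "s t = 0" if "t \<notin> {a<..b}" for t
        using that ab by (auto simp: s_def split: split_indicator)
      ultimately show "\<exists>s\<in>step_functions. (\<forall>t\<in>{a<..b}. \<bar>u t - s t\<bar> \<le> \<epsilon>) \<and> (\<forall>t. t \<notin> {a<..b} \<longrightarrow> s t = 0)"
        by blast
    qed
    then show "\<exists>d>0. \<forall>a b. a \<le> x \<and> x \<le> b \<and> b - a < d \<longrightarrow> P a b"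
      using l(1) r(1) by (intro exI[of _ "min dl dr"]) auto
  qed simp
  then obtain s where s: "s \<in> step_functions" "\<forall>t\<in>{0<..1}. \<bar>u t - s t\<bar> \<le> \<epsilon>" "\<forall>t. t \<notin> {0<..1} \<longrightarrow> s t = 0"
    unfolding P_def by auto
  \<comment> \<open>The half-open interval misses 0, so the value there is added as a multiple of
    the indicator of \<open>{0}\<close>.\<close>
  have step: "(\<lambda>t. s t + u 0 * (indicator {0..} t - indicator {0<..} t)) \<in> step_functions"
    by (intro step_functions.intros step_diff s)
  have close: "\<bar>u t - (s t + u 0 * (indicator {0..} t - indicator {0<..} t))\<bar> \<le> \<epsilon>" if "t \<in> {0..1}" for t
    using that s e by (cases "t = 0") auto
  show ?thesis by (rule bexI[OF ballI step]) (rule close)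
qed

lemma regulated_integrable:
  assumes "u \<in> G01" "0 \<le> a" "b \<le> 1"
  shows "u integrable_on {a..b}"
proof -
  have "u integrable_on cbox a b"
  proof (rule integrable_uniform_limit)
    fix e :: real assume "0 < e"
    then obtain s where "s \<in> step_functions" "\<forall>t\<in>{0..1}. \<bar>u t - s t\<bar> \<le> e"
      using regulated_step_approx[OF assms(1)] by blast
    then show "\<exists>g. (\<forall>x\<in>cbox a b. norm (u x - g x) \<le> e) \<and> g integrable_on cbox a b"
      using assms step_integrable[of s a b] by (intro exI[of _ s]) auto
  qed
  then show ?thesis by simp
qed

lemma regulated_bounded:
  assumes "u \<in> G01"
  shows "\<exists>B\<ge>0. \<forall>t\<in>{0..1}. \<bar>u t\<bar> \<le> B"
proof -
  obtain s where s: "s \<in> step_functions" "\<forall>t\<in>{0..1}. \<bar>u t - s t\<bar> \<le> 1"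
    using regulated_step_approx[OF assms, of 1] by auto
  obtain B where "\<forall>t. \<bar>s t\<bar> \<le> B" using step_bounded[OF s(1)] by blast
  then have "\<bar>u t\<bar> \<le> \<bar>B\<bar> + 1" if "t \<in> {0..1}" for t
  proof -
    have "\<bar>u t - s t\<bar> \<le> 1" using s that by blast
    moreover have "\<bar>s t\<bar> \<le> B" using \<open>\<forall>t. \<bar>s t\<bar> \<le> B\<close> by blast
    ultimately show ?thesis by linarith
  qed
  then show ?thesis by (intro exI[of _ "\<bar>B\<bar> + 1"]) auto
qed

text \<open>The limits of the approximants show that the values of \<open>u\<close> along
  \<open>F\<close> form a Cauchy filter; completeness then gives the limit without naming a
  candidate.\<close>

lemma one_sided_limit_uniform:
  fixes u :: "real \<Rightarrow> real"
  assumes F: "F \<noteq> bot"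
    and approx: "\<And>e. 0 < e \<Longrightarrow> \<exists>s l. (s \<longlongrightarrow> l) F \<and> (\<forall>\<^sub>F t in F. \<bar>u t - s t\<bar> \<le> e)"
  shows "\<exists>l. (u \<longlongrightarrow> l) F"
proof -
  have "cauchy_filter (filtermap u F)"
    unfolding cauchy_filter_metric_filtermap
  proof (intro allI impI)
    fix e :: real assume e: "0 < e"
    then obtain s l where lim: "(s \<longlongrightarrow> l) F" and close: "\<forall>\<^sub>F t in F. \<bar>u t - s t\<bar> \<le> e / 8"
      using approx[of "e / 8"] by auto
    have "\<forall>\<^sub>F t in F. dist (s t) l < e / 8" by (rule tendstoD[OF lim]) (use e in simp)
    with close have "\<forall>\<^sub>F t in F. dist (u t) l < e / 2"
      by eventually_elim (use e in \<open>unfold dist_real_def, linarith\<close>)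
    moreover have "dist (u t) (u t') < e" if "dist (u t) l < e / 2 \<and> dist (u t') l < e / 2" for t t'
      using that dist_triangle_half_l by blast
    ultimately show "\<exists>P. eventually P F \<and> (\<forall>x y. P x \<and> P y \<longrightarrow> dist (u x) (u y) < e)"
      by (intro exI[of _ "\<lambda>t. dist (u t) l < e / 2"]) auto
  qed
  from cauchy_filter_complete_converges[OF this complete_UNIV] F
  show ?thesis by (auto simp: filterlim_def filtermap_bot_iff)
qed

lemma G01_uniform_limit:
  assumes "\<And>e. 0 < e \<Longrightarrow> \<exists>s\<in>G01. \<forall>t\<in>{0..1}. \<bar>u t - s t\<bar> \<le> e"
  shows "u \<in> G01"
  unfolding G01_def regulated_on_def
proof (clarify, intro conjI allI impI)
  fix t :: real assume t: "0 \<le> t \<and> t < 1"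
  show "\<exists>l. (u \<longlongrightarrow> l) (at_right t)"
  proof (rule one_sided_limit_uniform)
    fix e :: real assume "0 < e"
    then obtain s where s: "s \<in> G01" "\<forall>t\<in>{0..1}. \<bar>u t - s t\<bar> \<le> e" using assms by blast
    have "\<forall>\<^sub>F t in at_right t. \<bar>u t - s t\<bar> \<le> e"
      using eventually_at_right_real[of t 1] t s(2) by (auto elim!: eventually_mono)
    then show "\<exists>s l. (s \<longlongrightarrow> l) (at_right t) \<and> (\<forall>\<^sub>F t in at_right t. \<bar>u t - s t\<bar> \<le> e)"
      using s(1) t unfolding G01_def regulated_on_def by blast
  qed simp
next
  fix t :: real assume t: "0 < t \<and> t \<le> 1"
  show "\<exists>l. (u \<longlongrightarrow> l) (at_left t)"
  proof (rule one_sided_limit_uniform)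
    fix e :: real assume "0 < e"
    then obtain s where s: "s \<in> G01" "\<forall>t\<in>{0..1}. \<bar>u t - s t\<bar> \<le> e" using assms by blast
    have "\<forall>\<^sub>F t in at_left t. \<bar>u t - s t\<bar> \<le> e"
      using eventually_at_left_real[of 0 t] t s(2) by (auto elim!: eventually_mono)
    then show "\<exists>s l. (s \<longlongrightarrow> l) (at_left t) \<and> (\<forall>\<^sub>F t in at_left t. \<bar>u t - s t\<bar> \<le> e)"
      using s(1) t unfolding G01_def regulated_on_def by blast
  qed simp
qed

section \<open>The Kurzweil--Henstock--Stieltjes integral\<close>

definition fine_partition ::
  "(real \<Rightarrow> real) \<Rightarrow> real \<Rightarrow> real \<Rightarrow> nat \<Rightarrow> (nat \<Rightarrow> real) \<Rightarrow> (nat \<Rightarrow> real) \<Rightarrow> bool" where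
  "fine_partition \<delta> a b m t \<xi> \<longleftrightarrow> t 0 = a \<and> t m = b \<and>
     (\<forall>i<m. t i < t (Suc i) \<and> \<xi> i \<in> {t i..t (Suc i)} \<and>
            {t i..t (Suc i)} \<subseteq> {\<xi> i - \<delta> (\<xi> i)<..<\<xi> i + \<delta> (\<xi> i)})"

definition stieltjes_sum ::
  "(real \<Rightarrow> real) \<Rightarrow> (real \<Rightarrow> real) \<Rightarrow> nat \<Rightarrow> (nat \<Rightarrow> real) \<Rightarrow> (nat \<Rightarrow> real) \<Rightarrow> real" where
  "stieltjes_sum v u m t \<xi> = (\<Sum>i<m. v (\<xi> i) * (u (t (Suc i)) - u (t i)))"

lemma has_KHS_integral_iff:
  "has_KHS_integral v u a b I \<longleftrightarrow>
     (\<forall>\<epsilon>>0. \<exists>\<delta>. (\<forall>s\<in>{a..b}. \<delta> s > 0) \<and>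
        (\<forall>m t \<xi>. fine_partition \<delta> a b m t \<xi> \<longrightarrow> \<bar>stieltjes_sum v u m t \<xi> - I\<bar> < \<epsilon>))"
  unfolding has_KHS_integral_def fine_partition_def stieltjes_sum_def by simp

lemma fine_partition_mono:
  assumes "fine_partition \<delta> a b m t \<xi>" "\<And>s. \<delta> s \<le> \<delta>' s"
  shows "fine_partition \<delta>' a b m t \<xi>"
proof -
  have "{\<xi> i - \<delta> (\<xi> i)<..<\<xi> i + \<delta> (\<xi> i)} \<subseteq> {\<xi> i - \<delta>' (\<xi> i)<..<\<xi> i + \<delta>' (\<xi> i)}" for i
    using assms(2)[of "\<xi> i"] by auto
  then show ?thesis using assms(1) unfolding fine_partition_def by (meson order_trans)
qed

lemma fine_partition_le:
  assumes "fine_partition \<delta> a b m t \<xi>" "i \<le> j" "j \<le> m"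
  shows "t i \<le> t j"
  using assms(2,3)
proof (induction j rule: dec_induct)
  case (step n)
  then show ?case using assms(1) unfolding fine_partition_def
    by (metis Suc_le_lessD less_imp_le order_trans Suc_leD)
qed simp

lemma fine_partition_bounds:
  assumes "fine_partition \<delta> a b m t \<xi>" "i \<le> m"
  shows "t i \<in> {a..b}"
  using fine_partition_le[OF assms(1), of 0 i] fine_partition_le[OF assms(1), of i m] assms
  unfolding fine_partition_def by auto

lemma fine_partition_append:
  assumes p: "fine_partition \<delta> a b m t \<xi>" and p': "fine_partition \<delta> b c m' t' \<xi>'"
  shows "fine_partition \<delta> a c (m + m') (\<lambda>i. if i \<le> m then t i else t' (i - m))
           (\<lambda>i. if i < m then \<xi> i else \<xi>' (i - m))"
proof -
  define T where "T i = (if i \<le> m then t i else t' (i - m))" for i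
  define X where "X i = (if i < m then \<xi> i else \<xi>' (i - m))" for i
  \<comment> \<open>At \<open>i = m\<close> both branches give the common end point
    \<open>b\<close>, so the second partition can be read off from index \<open>m\<close>
    onwards.\<close>
  have T: "T i = t' (i - m)" if "m \<le> i" for i
    using that p p' unfolding T_def fine_partition_def by auto
  have "T i < T (Suc i) \<and> X i \<in> {T i..T (Suc i)} \<and>
            {T i..T (Suc i)} \<subseteq> {X i - \<delta> (X i)<..<X i + \<delta> (X i)}" if "i < m + m'" for i
  proof (cases "i < m")
    case True
    then have "T i = t i" "T (Suc i) = t (Suc i)" "X i = \<xi> i" by (simp_all add: T_def X_def)
    then show ?thesis using p True unfolding fine_partition_def by simp
  next
    case False
    then have "T i = t' (i - m)" "T (Suc i) = t' (Suc (i - m))" "X i = \<xi>' (i - m)" "i - m < m'"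
      using that by (simp_all add: T X_def Suc_diff_le)
    then show ?thesis using p' unfolding fine_partition_def by simp
  qed
  moreover have "T 0 = a" "T (m + m') = c"
    using p p' T[of "m + m'"] unfolding fine_partition_def T_def by simp_all
  ultimately show ?thesis unfolding fine_partition_def T_def X_def by blast
qed

text \<open>Cousin's lemma, by bisection: a short interval around \<open>x\<close> is fine with the
  single tag \<open>x\<close>, and fine partitions of adjacent intervals concatenate.\<close>

lemma fine_partition_exists:
  assumes "a \<le> b" "\<And>s. s \<in> {a..b} \<Longrightarrow> 0 < \<delta> s"
  shows "\<exists>m t \<xi>. fine_partition \<delta> a b m t \<xi>"
proof -
  define P where "P c d \<longleftrightarrow> (a \<le> c \<and> c \<le> d \<and> d \<le> b \<longrightarrow> (\<exists>m t \<xi>. fine_partition \<delta> c d m t \<xi>))" for c d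
  have "P a b"
    using assms(1)
  proof (rule Bolzano)
    fix x y z assume *: "P x y" "P y z" "x \<le> y" "y \<le> z"
    show "P x z" unfolding P_def
    proof
      assume "a \<le> x \<and> x \<le> z \<and> z \<le> b"
      then have "a \<le> x \<and> x \<le> y \<and> y \<le> b" "a \<le> y \<and> y \<le> z \<and> z \<le> b" using * by auto
      then show "\<exists>m t \<xi>. fine_partition \<delta> x z m t \<xi>"
        using *(1,2) fine_partition_append unfolding P_def by meson
    qed
  next
    fix x assume x: "a \<le> x" "x \<le> b"
    have "P c d" if "c \<le> x \<and> x \<le> d \<and> d - c < \<delta> x" for c d
    proof (cases "c < d")
      case True
      then have "fine_partition \<delta> c d 1 (\<lambda>i. if i = 0 then c else d) (\<lambda>i. x)"
        using that unfolding fine_partition_def by auto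
      then show ?thesis unfolding P_def by blast
    next
      case False
      \<comment> \<open>A degenerate interval is partitioned into no pieces, since pieces must have
        positive length.\<close>
      have "fine_partition \<delta> c c 0 (\<lambda>i. c) (\<lambda>i. c)" unfolding fine_partition_def by simp
      then show ?thesis using False unfolding P_def by (metis antisym_conv2)
    qed
    then show "\<exists>d>0. \<forall>c e. c \<le> x \<and> x \<le> e \<and> e - c < d \<longrightarrow> P c e"
      using assms(2)[of x] x by auto
  qed
  then show ?thesis using assms(1) unfolding P_def by simp
qed

section \<open>Elementary integrals, and linearity in the integrator\<close>

lemma has_KHS_integral_point:
  assumes "has_KHS_integral v u a a I"
  shows "I = 0"
proof (rule ccontr)
  assume "I \<noteq> 0"
  then obtain \<delta> where "\<forall>m t \<xi>. fine_partition \<delta> a a m t \<xi> \<longrightarrow> \<bar>stieltjes_sum v u m t \<xi> - I\<bar> < \<bar>I\<bar>"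
    using assms unfolding has_KHS_integral_iff by (metis zero_less_abs_iff)
  \<comment> \<open>The empty partition is fine for every gauge, and its sum is 0.\<close>
  moreover have "fine_partition \<delta> a a 0 (\<lambda>_. a) (\<lambda>_. a)" unfolding fine_partition_def by simp
  ultimately have "\<bar>stieltjes_sum v u 0 (\<lambda>_. a) (\<lambda>_. a) - I\<bar> < \<bar>I\<bar>" by blast
  then show False unfolding stieltjes_sum_def by simp
qed

lemma stieltjes_sum_add_right:
  "stieltjes_sum v (\<lambda>x. u x + w x) m t \<xi> = stieltjes_sum v u m t \<xi> + stieltjes_sum v w m t \<xi>"
  unfolding stieltjes_sum_def by (simp add: algebra_simps sum.distrib sum_subtractf)

lemma stieltjes_sum_diff_right:
  "stieltjes_sum v (\<lambda>x. u x - w x) m t \<xi> = stieltjes_sum v u m t \<xi> - stieltjes_sum v w m t \<xi>"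
  unfolding stieltjes_sum_def by (simp add: algebra_simps sum.distrib sum_subtractf)

lemma stieltjes_sum_scale_right:
  "stieltjes_sum v (\<lambda>x. k * u x) m t \<xi> = k * stieltjes_sum v u m t \<xi>"
  unfolding stieltjes_sum_def sum_distrib_left by (simp add: algebra_simps)

lemma has_KHS_integral_add_right:
  assumes "has_KHS_integral v u a b I" "has_KHS_integral v w a b J"
  shows "has_KHS_integral v (\<lambda>x. u x + w x) a b (I + J)"
  unfolding has_KHS_integral_iff
proof (intro allI impI)
  fix e :: real assume e: "0 < e"
  obtain d where d: "\<forall>s\<in>{a..b}. 0 < d s"
      "\<And>m t \<xi>. fine_partition d a b m t \<xi> \<Longrightarrow> \<bar>stieltjes_sum v u m t \<xi> - I\<bar> < e / 2"
    using assms(1) e unfolding has_KHS_integral_iff by (metis half_gt_zero)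
  obtain d' where d': "\<forall>s\<in>{a..b}. 0 < d' s"
      "\<And>m t \<xi>. fine_partition d' a b m t \<xi> \<Longrightarrow> \<bar>stieltjes_sum v w m t \<xi> - J\<bar> < e / 2"
    using assms(2) e unfolding has_KHS_integral_iff by (metis half_gt_zero)
  have "\<bar>stieltjes_sum v (\<lambda>x. u x + w x) m t \<xi> - (I + J)\<bar> < e"
    if "fine_partition (\<lambda>s. min (d s) (d' s)) a b m t \<xi>" for m t \<xi>
  proof -
    have "\<bar>stieltjes_sum v u m t \<xi> - I\<bar> < e / 2" "\<bar>stieltjes_sum v w m t \<xi> - J\<bar> < e / 2"
      using d(2) d'(2) fine_partition_mono[OF that] by simp_all
    then show ?thesis unfolding stieltjes_sum_add_right by linarith
  qed
  then show "\<exists>\<delta>. (\<forall>s\<in>{a..b}. 0 < \<delta> s) \<and> (\<forall>m t \<xi>. fine_partition \<delta> a b m t \<xi> \<longrightarrow>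
      \<bar>stieltjes_sum v (\<lambda>x. u x + w x) m t \<xi> - (I + J)\<bar> < e)"
    using d(1) d'(1) by (intro exI[of _ "\<lambda>s. min (d s) (d' s)"]) simp
qed

lemma has_KHS_integral_scale_right:
  assumes "has_KHS_integral v u a b I"
  shows "has_KHS_integral v (\<lambda>x. k * u x) a b (k * I)"
  unfolding has_KHS_integral_iff
proof (intro allI impI)
  fix e :: real assume e: "0 < e"
  then have "0 < e / (\<bar>k\<bar> + 1)" by (simp add: divide_pos_pos add_nonneg_pos)
  then obtain d where d: "\<forall>s\<in>{a..b}. 0 < d s"
      "\<And>m t \<xi>. fine_partition d a b m t \<xi> \<Longrightarrow> \<bar>stieltjes_sum v u m t \<xi> - I\<bar> < e / (\<bar>k\<bar> + 1)"
    using assms unfolding has_KHS_integral_iff by metis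
  have "\<bar>stieltjes_sum v (\<lambda>x. k * u x) m t \<xi> - k * I\<bar> < e"
    if "fine_partition d a b m t \<xi>" for m t \<xi>
  proof -
    have "\<bar>stieltjes_sum v (\<lambda>x. k * u x) m t \<xi> - k * I\<bar> = \<bar>k\<bar> * \<bar>stieltjes_sum v u m t \<xi> - I\<bar>"
      unfolding stieltjes_sum_scale_right by (simp add: abs_mult flip: right_diff_distrib)
    also have "\<dots> \<le> \<bar>k\<bar> * (e / (\<bar>k\<bar> + 1))"
      using d(2)[OF that] by (intro mult_left_mono) auto
    also have "\<dots> < e" using e by (simp add: field_simps)
    finally show ?thesis .
  qed
  then show "\<exists>\<delta>. (\<forall>s\<in>{a..b}. 0 < \<delta> s) \<and> (\<forall>m t \<xi>. fine_partition \<delta> a b m t \<xi> \<longrightarrow>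
      \<bar>stieltjes_sum v (\<lambda>x. k * u x) m t \<xi> - k * I\<bar> < e)"
    using d(1) by blast
qed

text \<open>The gauge \<open>\<bar>s - c\<bar>\<close> forces \<open>c\<close> to be the tag of every interval that contains it.\<close>
lemma has_KHS_integral_single_jump:
  assumes const: "\<And>s t. s \<le> t \<Longrightarrow> c \<notin> {s..t} \<Longrightarrow> u s = u t"
  shows "has_KHS_integral v u a b (v c * (u b - u a))"
  unfolding has_KHS_integral_iff
proof (intro allI impI)
  fix e :: real assume e: "0 < e"
  have "stieltjes_sum v u m t \<xi> = v c * (u b - u a)"
    if p: "fine_partition (\<lambda>s. if s = c then 1 else \<bar>s - c\<bar>) a b m t \<xi>" for m t \<xi>
  proof -
    have "v (\<xi> i) * (u (t (Suc i)) - u (t i)) = v c * (u (t (Suc i)) - u (t i))" if "i < m" for i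
    proof (cases "c \<in> {t i..t (Suc i)}")
      case True
      have "{t i..t (Suc i)} \<subseteq> {\<xi> i - (if \<xi> i = c then 1 else \<bar>\<xi> i - c\<bar>)<..<\<xi> i + (if \<xi> i = c then 1 else \<bar>\<xi> i - c\<bar>)}"
        using p that unfolding fine_partition_def by blast
      from subsetD[OF this True] have "\<xi> i = c" by (auto split: if_splits)
      then show ?thesis by simp
    next
      case False
      then show ?thesis using const[of "t i" "t (Suc i)"] p that unfolding fine_partition_def by fastforce
    qed
    then have "stieltjes_sum v u m t \<xi> = (\<Sum>i<m. v c * (u (t (Suc i)) - u (t i)))"
      unfolding stieltjes_sum_def by (intro sum.cong) auto
    also have "\<dots> = v c * (u (t m) - u (t 0))"
      by (simp add: sum_lessThan_telescope[of "\<lambda>i. u (t i)"] flip: sum_distrib_left)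
    finally show ?thesis using p unfolding fine_partition_def by simp
  qed
  then show "\<exists>\<delta>. (\<forall>s\<in>{a..b}. 0 < \<delta> s) \<and> (\<forall>m t \<xi>. fine_partition \<delta> a b m t \<xi> \<longrightarrow>
      \<bar>stieltjes_sum v u m t \<xi> - v c * (u b - u a)\<bar> < e)"
    using e by (intro exI[of _ "\<lambda>s. if s = c then 1 else \<bar>s - c\<bar>"]) auto
qed

text \<open>For one jump at \<open>c\<close> the integral is \<open>v c * (s t - s 0)\<close>, from
  which all clauses are visible; they are stable under linear combinations of integrators.
  \<open>I\<close> is chosen before \<open>v\<close>, so that convergence of integrands can be
  compared under one operator.\<close>

lemma step_KHS_integral:
  assumes "s \<in> step_functions"
  shows "\<exists>I. \<forall>v. (\<forall>t. has_KHS_integral v s 0 t (I v t)) \<and> I v \<in> G01 \<and>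
           (\<forall>V. (\<forall>\<tau>\<in>{0..1}. (\<lambda>n. V n \<tau>) \<longlonglongrightarrow> v \<tau>) \<longrightarrow>
              (\<forall>t\<in>{0..1}. (\<lambda>n :: nat. I (V n) t) \<longlonglongrightarrow> I v t))"
  using assms
proof (induction rule: step_functions.induct)
  have jump: "\<exists>I. \<forall>v. (\<forall>t. has_KHS_integral v s 0 t (I v t)) \<and> I v \<in> G01 \<and>
           (\<forall>V. (\<forall>\<tau>\<in>{0..1}. (\<lambda>n. V n \<tau>) \<longlonglongrightarrow> v \<tau>) \<longrightarrow>
              (\<forall>t\<in>{0..1}. (\<lambda>n :: nat. I (V n) t) \<longlonglongrightarrow> I v t))"
    if s: "s \<in> step_functions" and const: "\<And>t t'. t \<le> t' \<Longrightarrow> c \<notin> {t..t'} \<Longrightarrow> s t = s t'" for s c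
  proof (intro exI[of _ "\<lambda>v t. v c * (s t - s 0)"] allI conjI impI ballI)
    fix v t show "has_KHS_integral v s 0 t (v c * (s t - s 0))"
      by (rule has_KHS_integral_single_jump[OF const])
  next
    fix v :: "real \<Rightarrow> real" show "(\<lambda>t. v c * (s t - s 0)) \<in> G01"
      by (rule G01_mult[OF G01_const G01_diff[OF step_in_G01[OF s] G01_const]])
  next
    fix v :: "real \<Rightarrow> real" and V :: "nat \<Rightarrow> real \<Rightarrow> real" and t :: real
    assume *: "\<forall>\<tau>\<in>{0..1}. (\<lambda>n. V n \<tau>) \<longlonglongrightarrow> v \<tau>" and t: "t \<in> {0..1}"
    show "(\<lambda>n. V n c * (s t - s 0)) \<longlonglongrightarrow> v c * (s t - s 0)"
    \<comment> \<open>Nothing is assumed about convergence at a \<open>c\<close> outside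
      \<open>[0, 1]\<close>; there the factor \<open>s t - s 0\<close> vanishes.\<close>
    proof (cases "c \<in> {0..1}")
      case True then show ?thesis using * by (auto intro: tendsto_mult_right)
    next
      case False then show ?thesis using const[of 0 t] t by auto
    qed
  qed
  show "\<exists>I. \<forall>v. (\<forall>t. has_KHS_integral v (indicator {c..}) 0 t (I v t)) \<and> I v \<in> G01 \<and>
           (\<forall>V. (\<forall>\<tau>\<in>{0..1}. (\<lambda>n. V n \<tau>) \<longlonglongrightarrow> v \<tau>) \<longrightarrow>
              (\<forall>t\<in>{0..1}. (\<lambda>n :: nat. I (V n) t) \<longlonglongrightarrow> I v t))" for c
    by (rule jump[of _ c, OF step_functions.closed_ray]) (auto split: split_indicator)
  show "\<exists>I. \<forall>v. (\<forall>t. has_KHS_integral v (indicator {c<..}) 0 t (I v t)) \<and> I v \<in> G01 \<and>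
           (\<forall>V. (\<forall>\<tau>\<in>{0..1}. (\<lambda>n. V n \<tau>) \<longlonglongrightarrow> v \<tau>) \<longrightarrow>
              (\<forall>t\<in>{0..1}. (\<lambda>n :: nat. I (V n) t) \<longlonglongrightarrow> I v t))" for c
    by (rule jump[of _ c, OF step_functions.open_ray]) (auto split: split_indicator)
next
  case (add s s')
  then obtain I I' where "\<forall>v. (\<forall>t. has_KHS_integral v s 0 t (I v t)) \<and> I v \<in> G01 \<and>
           (\<forall>V. (\<forall>\<tau>\<in>{0..1}. (\<lambda>n. V n \<tau>) \<longlonglongrightarrow> v \<tau>) \<longrightarrow>
              (\<forall>t\<in>{0..1}. (\<lambda>n :: nat. I (V n) t) \<longlonglongrightarrow> I v t))"
    "\<forall>v. (\<forall>t. has_KHS_integral v s' 0 t (I' v t)) \<and> I' v \<in> G01 \<and>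
           (\<forall>V. (\<forall>\<tau>\<in>{0..1}. (\<lambda>n. V n \<tau>) \<longlonglongrightarrow> v \<tau>) \<longrightarrow>
              (\<forall>t\<in>{0..1}. (\<lambda>n :: nat. I' (V n) t) \<longlonglongrightarrow> I' v t))"
    by blast
  then show ?case
    by (intro exI[of _ "\<lambda>v t. I v t + I' v t"])
      (simp add: has_KHS_integral_add_right G01_add tendsto_add)
next
  case (scale s k)
  then obtain I where "\<forall>v. (\<forall>t. has_KHS_integral v s 0 t (I v t)) \<and> I v \<in> G01 \<and>
           (\<forall>V. (\<forall>\<tau>\<in>{0..1}. (\<lambda>n. V n \<tau>) \<longlonglongrightarrow> v \<tau>) \<longrightarrow>
              (\<forall>t\<in>{0..1}. (\<lambda>n :: nat. I (V n) t) \<longlonglongrightarrow> I v t))"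
    by blast
  then show ?case
    by (intro exI[of _ "\<lambda>v t. k * I v t"])
      (simp add: has_KHS_integral_scale_right G01_mult[OF G01_const] tendsto_mult_left)
qed

section \<open>Integrands of bounded variation against regulated integrators\<close>

lemma variation_sum_le:
  assumes tv: "total_variation 0 1 v \<le> ennreal M" and M: "0 \<le> M"
    and w: "\<And>i. i < k \<Longrightarrow> w i \<le> w (Suc i)" "\<And>i. i \<le> k \<Longrightarrow> w i \<in> {0..1}"
  shows "(\<Sum>i<k. \<bar>v (w (Suc i)) - v (w i)\<bar>) \<le> M"
proof -
  \<comment> \<open>The finite chain is padded to a sequence by the empty interval from 0 to 0,
    whose terms vanish.\<close>
  define t s where "t i = (if i < k then w i else 0)" and "s i = (if i < k then w (Suc i) else 0)" for i
  have mono: "w i \<le> w j" if "i \<le> j" "j \<le> k" for i j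
    using that(1,2)
  proof (induction j rule: dec_induct)
    case (step n) then show ?case using w(1)[of n] by simp
  qed simp
  have "{t i<..<s i} \<inter> {t j<..<s j} = {}" if "i < j" for i j
    using mono[of "Suc i" j] that by (auto simp: t_def s_def)
  then have "disjoint_family (\<lambda>n. {t n<..<s n})"
    unfolding disjoint_family_on_def by (metis Int_commute linorder_neqE_nat)
  moreover have "\<forall>n. 0 \<le> t n \<and> t n \<le> s n \<and> s n \<le> 1"
  proof
    fix n show "0 \<le> t n \<and> t n \<le> s n \<and> s n \<le> 1"
      using w(1)[of n] w(2)[of n] w(2)[of "Suc n"] by (cases "n < k") (auto simp: t_def s_def)
  qed
  ultimately have "(\<Sum>n. ennreal \<bar>v (s n) - v (t n)\<bar>) \<le> total_variation 0 1 v"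
    unfolding total_variation_def by (intro SUP_upper2[of "(t, s)"]) auto
  also note tv
  also have "(\<Sum>n. ennreal \<bar>v (s n) - v (t n)\<bar>) = (\<Sum>n<k. ennreal \<bar>v (s n) - v (t n)\<bar>)"
    by (rule suminf_finite) (auto simp: s_def t_def)
  also have "\<dots> = (\<Sum>i<k. ennreal \<bar>v (w (Suc i)) - v (w i)\<bar>)"
    by (rule sum.cong) (auto simp: s_def t_def)
  also have "\<dots> = ennreal (\<Sum>i<k. \<bar>v (w (Suc i)) - v (w i)\<bar>)"
    by (rule sum_ennreal) simp
  finally show ?thesis using M by simp
qed

text \<open>The bound holds for every partition, whatever the gauge, and sees only the size of the
  integrator. This is what makes replacing \<open>u\<close> by a step function harmless. One
  \<open>M\<close> bounds the last value of \<open>v\<close>, the other the sum of its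
  increments.\<close>

lemma stieltjes_sum_bound:
  assumes tv: "total_variation 0 1 v \<le> ennreal M" and M: "0 \<le> M" and v0: "v 0 = 0"
    and u: "\<And>t. t \<in> {0..1} \<Longrightarrow> \<bar>u t\<bar> \<le> e"
    and b: "b \<le> 1" and p: "fine_partition \<delta> 0 b m t \<xi>"
  shows "\<bar>stieltjes_sum v u m t \<xi>\<bar> \<le> 2 * M * e"
proof -
  \<comment> \<open>The tags, preceded by \<open>0\<close>: since \<open>v 0 = 0\<close>, summation by parts leaves no boundary term there.\<close>
  define w where "w i = (case i of 0 \<Rightarrow> 0 | Suc j \<Rightarrow> \<xi> j)" for i
  have w0: "w 0 = 0" and wS: "w (Suc i) = \<xi> i" for i by (simp_all add: w_def)
  have t01: "t i \<in> {0..1}" if "i \<le> m" for i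
    using fine_partition_bounds[OF p that] b by auto
  have \<xi>: "t i \<le> \<xi> i" "\<xi> i \<le> t (Suc i)" if "i < m" for i
    using p that unfolding fine_partition_def by auto
  have w01: "w i \<in> {0..1}" if "i \<le> m" for i
    using that \<xi>[of "i - 1"] t01[of "i - 1"] t01[of i] by (cases i) (auto simp: w0 wS)
  have wle: "w i \<le> w (Suc i)" if "i < m" for i
  proof (cases i)
    case 0 then show ?thesis using w01[of "Suc i"] that w0 by auto
  next
    case (Suc j) then show ?thesis using \<xi>(2)[of j] \<xi>(1)[of i] that by (auto simp: wS)
  qed
  have var: "(\<Sum>i<m. \<bar>v (w (Suc i)) - v (w i)\<bar>) \<le> M"
    by (rule variation_sum_le[OF tv M, of m w]) (fact wle w01)+
  have e: "0 \<le> e" using u[of 0] by auto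
  have abel: "(\<Sum>i<k. v (w (Suc i)) * (u (t (Suc i)) - u (t i))) =
      v (w k) * u (t k) - (\<Sum>i<k. (v (w (Suc i)) - v (w i)) * u (t i))" for k
    by (induction k) (simp_all add: w0 v0 algebra_simps)
  have "v (w m) = (\<Sum>i<m. v (w (Suc i)) - v (w i))"
    by (simp add: sum_lessThan_telescope[of "\<lambda>i. v (w i)"] w0 v0)
  then have "\<bar>v (w m)\<bar> \<le> M" using sum_abs[of "\<lambda>i. v (w (Suc i)) - v (w i)" "{..<m}"] var by linarith
  then have "\<bar>v (w m) * u (t m)\<bar> \<le> M * e"
    unfolding abs_mult using u[OF t01[of m]] M by (intro mult_mono) auto
  moreover have "\<bar>\<Sum>i<m. (v (w (Suc i)) - v (w i)) * u (t i)\<bar> \<le> M * e"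
  proof -
    have "\<bar>\<Sum>i<m. (v (w (Suc i)) - v (w i)) * u (t i)\<bar> \<le> (\<Sum>i<m. \<bar>v (w (Suc i)) - v (w i)\<bar> * e)"
    proof (rule order_trans[OF sum_abs], rule sum_mono)
      fix i assume "i \<in> {..<m}"
      then show "\<bar>(v (w (Suc i)) - v (w i)) * u (t i)\<bar> \<le> \<bar>v (w (Suc i)) - v (w i)\<bar> * e"
        unfolding abs_mult using u[OF t01[of i]] by (intro mult_left_mono) auto
    qed
    also have "\<dots> \<le> M * e"
      unfolding sum_distrib_right[symmetric] using var e by (rule mult_right_mono)
    finally show ?thesis .
  qed
  moreover have "stieltjes_sum v u m t \<xi> =
      v (w m) * u (t m) - (\<Sum>i<m. (v (w (Suc i)) - v (w i)) * u (t i))"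
    unfolding stieltjes_sum_def abel[symmetric] by (simp add: wS)
  ultimately show ?thesis by linarith
qed

text \<open>By Cousin's lemma some partition is fine for the gauge of the difference of integrators,
  and the bound on its sum passes to the integral.\<close>

lemma has_KHS_integral_close:
  assumes tv: "total_variation 0 1 v \<le> ennreal M" and M: "0 \<le> M" and v0: "v 0 = 0"
    and I: "has_KHS_integral v u 0 b I" "has_KHS_integral v w 0 b J"
    and uw: "\<And>t. t \<in> {0..1} \<Longrightarrow> \<bar>u t - w t\<bar> \<le> e"
    and b: "b \<in> {0..1}"
  shows "\<bar>I - J\<bar> \<le> 2 * M * e"
proof (rule field_le_epsilon)
  fix d :: real assume d: "0 < d"
  have diff: "has_KHS_integral v (\<lambda>x. u x + (-1) * w x) 0 b (I + (-1) * J)"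
    by (intro has_KHS_integral_add_right has_KHS_integral_scale_right I)
  obtain \<delta> where \<delta>: "\<forall>s\<in>{0..b}. 0 < \<delta> s" "\<And>m t \<xi>. fine_partition \<delta> 0 b m t \<xi> \<Longrightarrow>
      \<bar>stieltjes_sum v (\<lambda>x. u x + (-1) * w x) m t \<xi> - (I + (-1) * J)\<bar> < d"
    using diff[unfolded has_KHS_integral_iff, rule_format, OF d] by (elim exE conjE) simp
  obtain m t \<xi> where p: "fine_partition \<delta> 0 b m t \<xi>"
    using fine_partition_exists[of 0 b \<delta>] \<delta>(1) b by auto
  have "\<bar>stieltjes_sum v (\<lambda>x. u x + (-1) * w x) m t \<xi>\<bar> \<le> 2 * M * e"
    by (rule stieltjes_sum_bound[OF tv M v0 _ _ p]) (use uw b in auto)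
  then show "\<bar>I - J\<bar> \<le> 2 * M * e + d" using \<delta>(2)[OF p] by linarith
qed

text \<open>The class that contains the integrand \<open>g t (x t)\<close> for every regulated
  \<open>x\<close>, with one \<open>M\<close> for all of them.\<close>

definition normalized_BV :: "real \<Rightarrow> (real \<Rightarrow> real) set" where
  "normalized_BV M = {v. v 0 = 0 \<and> total_variation 0 1 v \<le> ennreal M}"

text \<open>The integrals \<open>I k\<close> against step functions converge at the rate
  \<open>4 * M * e k\<close>, uniformly over the class of integrands and over \<open>t\<close>.
  Existence, regularity and continuity of the limit \<open>J\<close> therefore follow from the same
  facts for the \<open>I k\<close>.\<close>

lemma regulated_KHS_operator:
  assumes u: "u \<in> G01" and M: "0 \<le> M"
  shows "\<exists>J B. (\<forall>v\<in>normalized_BV M. J v \<in> G01 \<and>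
             (\<forall>t\<in>{0..1}. has_KHS_integral v u 0 t (J v t) \<and> \<bar>J v t\<bar> \<le> B)) \<and>
           (\<forall>V :: nat \<Rightarrow> real \<Rightarrow> real. \<forall>v\<in>normalized_BV M.
             (\<forall>n. V n \<in> normalized_BV M) \<and> (\<forall>\<tau>\<in>{0..1}. (\<lambda>n. V n \<tau>) \<longlonglongrightarrow> v \<tau>) \<longrightarrow>
             (\<forall>t\<in>{0..1}. (\<lambda>n. J (V n) t) \<longlonglongrightarrow> J v t))"
proof -
  define e where "e k = 1 / real (Suc k)" for k
  have e: "0 < e k" "l \<ge> k \<Longrightarrow> e l \<le> e k" for k l by (simp_all add: e_def frac_le)
  have e_small: "\<exists>k. C * e k < \<epsilon>" if "0 < \<epsilon>" for C \<epsilon>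
  proof -
    obtain k where "C / \<epsilon> < real k" using reals_Archimedean2 by blast
    then have "C / \<epsilon> < real (Suc k)" by simp
    then show ?thesis using that unfolding e_def by (intro exI[of _ k]) (simp add: field_simps)
  qed
  have "\<forall>k. \<exists>s. s \<in> step_functions \<and> (\<forall>t\<in>{0..1}. \<bar>u t - s t\<bar> \<le> e k)"
    using regulated_step_approx[OF u e(1)] by blast
  then obtain s where s: "\<And>k. s k \<in> step_functions" "\<And>k t. t \<in> {0..1} \<Longrightarrow> \<bar>u t - s k t\<bar> \<le> e k"
    by metis
  define is_op where "is_op s I \<longleftrightarrow> (\<forall>v. (\<forall>t. has_KHS_integral v s 0 t (I v t)) \<and> I v \<in> G01 \<and>
           (\<forall>V. (\<forall>\<tau>\<in>{0..1}. (\<lambda>n. V n \<tau>) \<longlonglongrightarrow> v \<tau>) \<longrightarrow>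
              (\<forall>t\<in>{0..1}. (\<lambda>n :: nat. I (V n) t) \<longlonglongrightarrow> I v t)))" for s I
  have "\<forall>k. \<exists>I. is_op (s k) I"
    using step_KHS_integral[OF s(1)] unfolding is_op_def by simp
  then obtain I where "\<And>k. is_op (s k) (I k)" by metis
  then have I: "\<And>k v t. has_KHS_integral v (s k) 0 t (I k v t)" "\<And>k v. I k v \<in> G01"
    and I_lim: "\<And>k V v t. (\<And>\<tau>. \<tau> \<in> {0..1} \<Longrightarrow> (\<lambda>n. V n \<tau>) \<longlonglongrightarrow> v \<tau>) \<Longrightarrow> t \<in> {0..1} \<Longrightarrow>
      (\<lambda>n :: nat. I k (V n) t) \<longlonglongrightarrow> I k v t"
    unfolding is_op_def by blast+
  have close: "\<bar>I k v t - I l v t\<bar> \<le> 4 * M * e k" if v: "v \<in> normalized_BV M" and t: "t \<in> {0..1}" and "k \<le> l" for k l v t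
  proof -
    \<comment> \<open>Both step functions are compared with \<open>u\<close>; the factor
      \<open>2 * M\<close> of the stability estimate then gives the constant 4.\<close>
    have "\<bar>s k t - s l t\<bar> \<le> 2 * e k" if "t \<in> {0..1}" for t
      using s(2)[OF that, of k] s(2)[OF that, of l] e(2)[OF \<open>k \<le> l\<close>] by linarith
    then have "\<bar>I k v t - I l v t\<bar> \<le> 2 * M * (2 * e k)"
      using v t by (intro has_KHS_integral_close[OF _ M _ I(1) I(1)]) (auto simp: normalized_BV_def)
    then show ?thesis by simp
  qed
  define J where "J v t = lim (\<lambda>k. I k v t)" for v t
  have J: "(\<lambda>k. I k v t) \<longlonglongrightarrow> J v t" if v: "v \<in> normalized_BV M" and t: "t \<in> {0..1}" for v t
  proof -
    have "Cauchy (\<lambda>k. I k v t)"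
    proof (rule metric_CauchyI)
      fix \<epsilon> :: real assume "0 < \<epsilon>"
      then obtain k where k: "8 * M * e k < \<epsilon>" using e_small by blast
      have "dist (I m v t) (I n v t) < \<epsilon>" if "k \<le> m" "k \<le> n" for m n
        using close[OF v t that(1)] close[OF v t that(2)] k unfolding dist_real_def by linarith
      then show "\<exists>k. \<forall>m\<ge>k. \<forall>n\<ge>k. dist (I m v t) (I n v t) < \<epsilon>" by blast
    qed
    then show ?thesis unfolding J_def by (simp add: Cauchy_convergent convergent_LIMSEQ_iff[symmetric])
  qed
  have J_close: "\<bar>I k v t - J v t\<bar> \<le> 4 * M * e k" if v: "v \<in> normalized_BV M" and t: "t \<in> {0..1}" for k v t
  proof (rule tendsto_upperbound)
    show "(\<lambda>l. \<bar>I k v t - I l v t\<bar>) \<longlonglongrightarrow> \<bar>I k v t - J v t\<bar>"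
      by (intro tendsto_intros J that)
    show "\<forall>\<^sub>F l in sequentially. \<bar>I k v t - I l v t\<bar> \<le> 4 * M * e k"
      using eventually_ge_at_top[of k] by eventually_elim (rule close[OF that])
  qed simp
  have KHS: "has_KHS_integral v u 0 t (J v t)" if v: "v \<in> normalized_BV M" and t: "t \<in> {0..1}" for v t
    unfolding has_KHS_integral_iff
  proof (intro allI impI)
    fix \<epsilon> :: real assume \<epsilon>: "0 < \<epsilon>"
    \<comment> \<open>Replacing \<open>u\<close> by \<open>s k\<close> in the sum costs
      \<open>2 * M * e k\<close>, and passing from \<open>I k\<close> to \<open>J\<close> costs
      \<open>4 * M * e k\<close>.\<close>
    obtain k where k: "6 * M * e k < \<epsilon> / 2" using e_small[OF half_gt_zero[OF \<epsilon>]] by blast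
    have "0 < \<epsilon> / 2" using \<epsilon> by simp
    with I(1)[of v k t, unfolded has_KHS_integral_iff]
    obtain \<delta> where \<delta>: "\<forall>x\<in>{0..t}. 0 < \<delta> x" "\<And>m r \<xi>. fine_partition \<delta> 0 t m r \<xi> \<Longrightarrow>
        \<bar>stieltjes_sum v (s k) m r \<xi> - I k v t\<bar> < \<epsilon> / 2"
      by blast
    have "\<bar>stieltjes_sum v u m r \<xi> - J v t\<bar> < \<epsilon>" if p: "fine_partition \<delta> 0 t m r \<xi>" for m r \<xi>
    proof -
      have "\<bar>stieltjes_sum v (\<lambda>x. u x - s k x) m r \<xi>\<bar> \<le> 2 * M * e k"
        by (rule stieltjes_sum_bound[OF _ M _ _ _ p]) (use v t s(2) in \<open>auto simp: normalized_BV_def\<close>)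
      then show ?thesis
        using \<delta>(2)[OF p] J_close[OF v t, of k] k unfolding stieltjes_sum_diff_right by linarith
    qed
    then show "\<exists>\<delta>. (\<forall>x\<in>{0..t}. 0 < \<delta> x) \<and> (\<forall>m r \<xi>. fine_partition \<delta> 0 t m r \<xi> \<longrightarrow>
        \<bar>stieltjes_sum v u m r \<xi> - J v t\<bar> < \<epsilon>)"
      using \<delta>(1) by blast
  qed
  have G01: "J v \<in> G01" if v: "v \<in> normalized_BV M" for v
  proof (rule G01_uniform_limit)
    fix \<epsilon> :: real assume "0 < \<epsilon>"
    then obtain k where "4 * M * e k < \<epsilon>" using e_small by blast
    then have "\<bar>J v t - I k v t\<bar> \<le> \<epsilon>" if "t \<in> {0..1}" for t
      using J_close[OF v that, of k] by linarith
    then show "\<exists>s\<in>G01. \<forall>t\<in>{0..1}. \<bar>J v t - s t\<bar> \<le> \<epsilon>" using I(2) by blast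
  qed
  obtain B where B: "\<forall>t\<in>{0..1}. \<bar>u t\<bar> \<le> B" using regulated_bounded[OF u] by blast
  have bound: "\<bar>J v t\<bar> \<le> 2 * M * B" if v: "v \<in> normalized_BV M" and t: "t \<in> {0..1}" for v t
  proof -
    \<comment> \<open>Comparison with the zero integrator turns the stability estimate into a bound
      on \<open>J\<close>.\<close>
    have zero: "has_KHS_integral v (\<lambda>x. 0) 0 t 0"
      using has_KHS_integral_single_jump[of 0 "\<lambda>x. 0" v 0 t] by simp
    have "\<bar>J v t - 0\<bar> \<le> 2 * M * B"
      by (rule has_KHS_integral_close[OF _ M _ KHS[OF v t] zero]) (use v t B in \<open>auto simp: normalized_BV_def\<close>)
    then show ?thesis by simp
  qed
  have lim: "(\<lambda>n. J (V n) t) \<longlonglongrightarrow> J v t"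
    if V: "\<And>n. V n \<in> normalized_BV M" and v: "v \<in> normalized_BV M"
      and lim: "\<And>\<tau>. \<tau> \<in> {0..1} \<Longrightarrow> (\<lambda>n. V n \<tau>) \<longlonglongrightarrow> v \<tau>" and t: "t \<in> {0..1}" for V :: "nat \<Rightarrow> real \<Rightarrow> real" and v t
  proof (rule LIMSEQ_I)
    fix \<epsilon> :: real assume \<epsilon>: "0 < \<epsilon>"
    \<comment> \<open>The approximation error occurs twice, at \<open>V n\<close> and at
      \<open>v\<close>, and does not depend on \<open>n\<close>.\<close>
    obtain k where k: "8 * M * e k < \<epsilon> / 2" using e_small[OF half_gt_zero[OF \<epsilon>]] by blast
    obtain N where N: "\<And>n. n \<ge> N \<Longrightarrow> norm (I k (V n) t - I k v t) < \<epsilon> / 2"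
      using LIMSEQ_D[OF I_lim[of V v t k, OF lim t], of "\<epsilon> / 2"] \<epsilon> by auto
    have "norm (J (V n) t - J v t) < \<epsilon>" if "n \<ge> N" for n
      using N[OF that] J_close[OF V[of n] t, of k] J_close[OF v t, of k] k unfolding real_norm_def by linarith
    then show "\<exists>N. \<forall>n\<ge>N. norm (J (V n) t - J v t) < \<epsilon>" by blast
  qed
  show ?thesis
    by (rule exI[of _ J], rule exI[of _ "2 * M * B"]) (intro conjI ballI allI impI; (elim conjE)?; rule KHS G01 bound lim; simp)
qed

section \<open>Fixed points of operators on regulated functions\<close>

text \<open>On the right of \<open>t\<close> the floor keeps its value at \<open>t\<close>; on the
  left it equals the ceiling minus 1, which is a different value exactly when \<open>c * t\<close>
  is an integer.\<close>

lemma floor_composition_in_G01: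
  fixes h :: "int \<Rightarrow> real" and c :: real
  assumes c: "0 < c"
  shows "(\<lambda>t. h \<lfloor>c * t\<rfloor>) \<in> G01"
  unfolding G01_def regulated_on_def
proof (clarify, intro conjI allI impI)
  fix t :: real
  define k where "k = \<lfloor>c * t\<rfloor>"
  have "t < (k + 1) / c" using c unfolding k_def by (simp add: field_simps) linarith
  from eventually_at_right_real[OF this] have "\<forall>\<^sub>F t' in at_right t. h \<lfloor>c * t'\<rfloor> = h k"
  proof eventually_elim
    case (elim t')
    then have "c * t < c * t'" "c * t' < k + 1" using c by (simp_all add: field_simps)
    then have "\<lfloor>c * t'\<rfloor> = k" unfolding k_def by (intro floor_unique) linarith+
    then show ?case by simp
  qed
  then show "\<exists>l. ((\<lambda>t. h \<lfloor>c * t\<rfloor>) \<longlongrightarrow> l) (at_right t)" by (intro exI) (rule tendsto_eventually)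
next
  fix t :: real
  define k where "k = \<lceil>c * t\<rceil> - 1"
  have "k / c < t" using c unfolding k_def by (simp add: field_simps) linarith
  from eventually_at_left_real[OF this] have "\<forall>\<^sub>F t' in at_left t. h \<lfloor>c * t'\<rfloor> = h k"
  proof eventually_elim
    case (elim t')
    then have "k < c * t'" "c * t' < c * t" using c by (simp_all add: field_simps)
    then have "\<lfloor>c * t'\<rfloor> = k" unfolding k_def by (intro floor_unique) linarith+
    then show ?case by simp
  qed
  then show "\<exists>l. ((\<lambda>t. h \<lfloor>c * t\<rfloor>) \<longlongrightarrow> l) (at_left t)" by (intro exI) (rule tendsto_eventually)
qed

text \<open>A step function on the grid is coded by its node values, and \<open>\<Phi>\<close>
  returns the node values of its image under \<open>T\<close>. A fixed code agrees with its image at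
  the nodes, and the Lipschitz bound covers the distance \<open>1/n\<close> to the next
  node.\<close>

lemma approximate_fixpoint_G01:
  fixes T :: "(real \<Rightarrow> real) \<Rightarrow> real \<Rightarrow> real" and n :: nat
  assumes bound: "\<And>x t. x \<in> G01 \<Longrightarrow> t \<in> {0..1} \<Longrightarrow> \<bar>T x t\<bar> \<le> R" and R: "0 < R"
    and lip: "\<And>x s t. x \<in> G01 \<Longrightarrow> s \<in> {0..1} \<Longrightarrow> t \<in> {0..1} \<Longrightarrow> \<bar>T x s - T x t\<bar> \<le> L * \<bar>s - t\<bar>"
    and cont: "\<And>(X :: nat \<Rightarrow> real \<Rightarrow> real) x t. (\<And>n. X n \<in> G01) \<Longrightarrow> x \<in> G01 \<Longrightarrow>
      (\<And>\<tau>. \<tau> \<in> {0..1} \<Longrightarrow> (\<lambda>n. X n \<tau>) \<longlonglongrightarrow> x \<tau>) \<Longrightarrow> t \<in> {0..1} \<Longrightarrow> (\<lambda>n. T (X n) t) \<longlonglongrightarrow> T x t"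
    and L: "0 \<le> L" and n: "0 < n"
  shows "\<exists>x\<in>G01. \<forall>t\<in>{0..1}. \<bar>x t - T x t\<bar> \<le> L / n"
proof -
  let ?Q = "UNIV \<rightarrow> {0..1} :: (nat \<Rightarrow> real) set"
  define S where "S a = (\<lambda>t. (2 * a (nat \<lfloor>real n * t\<rfloor>) - 1) * R)" for a :: "nat \<Rightarrow> real"
  \<comment> \<open>The affine map between \<open>[-R, R]\<close> and \<open>[0, 1]\<close> is
    inverse to the one in \<open>S\<close>. There are \<open>n + 1\<close> nodes, since
    \<open>t = 1\<close> has index \<open>n\<close>; the remaining coordinates are set to 0.\<close>
  define \<Phi> where "\<Phi> a i = (if i \<le> n then (T (S a) (i / n) / R + 1) / 2 else 0)" for a and i :: nat
  have S: "S a \<in> G01" for a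
    unfolding S_def using n by (intro floor_composition_in_G01[of _ "\<lambda>k. (2 * a (nat k) - 1) * R"]) simp
  have node: "real i / real n \<in> {0..1}" if "i \<le> n" for i using that n by auto
  have maps: "\<Phi> a \<in> ?Q" for a
  proof
    fix i
    show "\<Phi> a i \<in> {0..1}"
    proof (cases "i \<le> n")
      case True
      have "\<bar>T (S a) (i / n) / R\<bar> \<le> 1" using bound[OF S node[OF True], of a] R by simp
      then show ?thesis using True by (auto simp: \<Phi>_def simp del: abs_divide)
    qed (simp add: \<Phi>_def)
  qed
  have "continuous_on ?Q \<Phi>"
  proof (rule continuous_on_coordinatewise_then_product)
    fix i
    show "continuous_on ?Q (\<lambda>a. \<Phi> a i)"
    proof (cases "i \<le> n")
      case True
      show ?thesis
        \<comment> \<open>Convergence in the product is coordinatewise, so the step functions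
          converge pointwise and \<open>cont\<close> applies.\<close>
        unfolding continuous_on_sequentially
      proof (intro allI ballI impI, elim conjE)
        fix A :: "nat \<Rightarrow> nat \<Rightarrow> real" and a assume "A \<longlonglongrightarrow> a"
        then have "(\<lambda>k. S (A k) t) \<longlonglongrightarrow> S a t" for t
          unfolding S_def tendsto_fun_iff by (intro tendsto_intros) simp
        then have "(\<lambda>k. T (S (A k)) (i / n)) \<longlonglongrightarrow> T (S a) (i / n)"
          by (intro cont S node True)
        then show "((\<lambda>a. \<Phi> a i) \<circ> A) \<longlonglongrightarrow> \<Phi> a i"
          using True R by (auto simp: \<Phi>_def o_def intro!: tendsto_intros)
      qed
    qed (simp add: \<Phi>_def)
  qed
  from hilbert_cube_fixpoint[OF this maps] obtain a where fixed: "\<Phi> a = a" by blast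
  have "\<bar>S a t - T (S a) t\<bar> \<le> L / n" if t: "t \<in> {0..1}" for t
  proof -
    define i where "i = nat \<lfloor>real n * t\<rfloor>"
    have i: "real i \<le> real n * t" "real n * t < real i + 1" using t unfolding i_def by (simp_all add: floor_less_iff) 
    moreover have "real n * t \<le> real n" using t n by (simp add: mult_left_le)
    ultimately have "i \<le> n" by linarith
    have "S a t = (2 * a i - 1) * R" by (simp add: S_def i_def)
    also have "a i = (T (S a) (i / n) / R + 1) / 2" using fun_cong[OF fixed, of i] \<open>i \<le> n\<close> by (simp add: \<Phi>_def)
    finally have "S a t = T (S a) (i / n)" using R by (simp add: field_simps)
    then have "\<bar>S a t - T (S a) t\<bar> \<le> L * \<bar>i / n - t\<bar>"
      using lip[OF S node[OF \<open>i \<le> n\<close>] t, of a] by simp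
    also have "real i / n \<le> t" "t \<le> i / n + 1 / n" using i n by (simp_all add: field_simps)
    then have "\<bar>i / n - t\<bar> \<le> 1 / n" by linarith
    then have "L * \<bar>i / n - t\<bar> \<le> L / n" using L mult_left_mono by fastforce
    finally show ?thesis .
  qed
  with S show ?thesis by blast
qed

text \<open>The approximate fixed points are merely regulated, so compactness is sought for their
  images, which are uniformly bounded and equicontinuous. Both sequences have the same pointwise
  limit because their distance tends to 0.\<close>

theorem fixpoint_G01:
  fixes T :: "(real \<Rightarrow> real) \<Rightarrow> real \<Rightarrow> real"
  assumes bound: "\<And>x t. x \<in> G01 \<Longrightarrow> t \<in> {0..1} \<Longrightarrow> \<bar>T x t\<bar> \<le> R" and R: "0 < R"
    and lip: "\<And>x s t. x \<in> G01 \<Longrightarrow> s \<in> {0..1} \<Longrightarrow> t \<in> {0..1} \<Longrightarrow> \<bar>T x s - T x t\<bar> \<le> L * \<bar>s - t\<bar>"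
    and cont: "\<And>(X :: nat \<Rightarrow> real \<Rightarrow> real) x t. (\<And>n. X n \<in> G01) \<Longrightarrow> x \<in> G01 \<Longrightarrow>
      (\<And>\<tau>. \<tau> \<in> {0..1} \<Longrightarrow> (\<lambda>n. X n \<tau>) \<longlonglongrightarrow> x \<tau>) \<Longrightarrow> t \<in> {0..1} \<Longrightarrow> (\<lambda>n. T (X n) t) \<longlonglongrightarrow> T x t"
    and L: "0 \<le> L"
  shows "\<exists>x\<in>G01. \<forall>t\<in>{0..1}. T x t = x t"
proof -
  have "\<forall>n. \<exists>x. x \<in> G01 \<and> (\<forall>t\<in>{0..1}. \<bar>x t - T x t\<bar> \<le> L / Suc n)"
    using approximate_fixpoint_G01[of T R L, OF bound R lip cont L zero_less_Suc] by blast
  then obtain X where X: "\<And>n. X n \<in> G01"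
    and close: "\<And>n t. t \<in> {0..1} \<Longrightarrow> \<bar>X n t - T (X n) t\<bar> \<le> L / Suc n"
    by metis
  obtain y k where y: "continuous_on {0..1} y" and k: "strict_mono (k :: nat \<Rightarrow> nat)"
    and unif: "\<And>e. 0 < e \<Longrightarrow> \<exists>N. \<forall>n t. n \<ge> N \<and> t \<in> {0..1} \<longrightarrow> norm (T (X (k n)) t - y t) < e"
  proof (rule Arzela_Ascoli[of "{0..1::real}" "\<lambda>n. T (X n)" R])
    show "norm (T (X n) t) \<le> R" if "t \<in> {0..1}" for n t using bound[OF X that] by simp
    fix t e :: real assume t: "t \<in> {0..1}" and e: "0 < e"
    have "norm (T (X n) t - T (X n) s) < e" if "s \<in> {0..1}" "norm (t - s) < e / (L + 1)" for n s
    proof -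
      \<comment> \<open>The denominator \<open>L + 1\<close> stays positive when
        \<open>L = 0\<close>.\<close>
      have "L * \<bar>t - s\<bar> \<le> L * (e / (L + 1))" using that L by (intro mult_left_mono) auto
      also have "\<dots> < e" using e L by (simp add: field_simps)
      finally show ?thesis using lip[OF X t that(1), of n] by simp
    qed
    then show "\<exists>d>0. \<forall>n s. s \<in> {0..1} \<and> norm (t - s) < d \<longrightarrow> norm (T (X n) t - T (X n) s) < e"
      using e L by (intro exI[of _ "e / (L + 1)"]) auto
  qed auto
  have y_G01: "y \<in> G01" by (rule G01_continuous[OF y])
  have TX: "(\<lambda>n. T (X (k n)) t) \<longlonglongrightarrow> y t" if "t \<in> {0..1}" for t
    using unif that unfolding LIMSEQ_iff by metis
  have Xy: "(\<lambda>n. X (k n) t) \<longlonglongrightarrow> y t" if t: "t \<in> {0..1}" for t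
  proof -
    have "(\<lambda>n. L / Suc (k n)) \<longlonglongrightarrow> 0"
      using LIMSEQ_subseq_LIMSEQ[OF _ k, of "\<lambda>n. L / Suc n"] LIMSEQ_Suc[OF lim_const_over_n[of L]]
      by (simp add: o_def)
    then have "(\<lambda>n. X (k n) t - T (X (k n)) t) \<longlonglongrightarrow> 0"
      by (rule Lim_null_comparison[rotated]) (use close[OF t] in auto)
    from tendsto_add[OF this TX[OF t]] show ?thesis by simp
  qed
  have "T y t = y t" if t: "t \<in> {0..1}" for t
    using cont[OF X y_G01 Xy t] TX[OF t] by (rule LIMSEQ_unique)
  with y_G01 show ?thesis by blast
qed

text \<open>\<open>H3'\<close> and \<open>H6\<close> use the same \<open>h\<close> and
  \<open>M\<close> for all radii, so this turns them into bounds on all of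
  \<open>G01\<close>.\<close>

lemma G01_in_some_ball: "x \<in> G01 \<Longrightarrow> \<exists>r>0. x \<in> G01_ball r"
  unfolding G01_ball_def by (intro exI[of _ "max 1 (G01_norm x)"]) auto

lemma indefinite_integral_bounded_lipschitz:
  fixes d :: "real \<Rightarrow> real"
  assumes int: "d integrable_on {0..1}" and bound: "\<And>\<tau>. \<tau> \<in> {0..1} \<Longrightarrow> \<bar>d \<tau>\<bar> \<le> K"
    and s: "s \<in> {0..1}" and t: "t \<in> {0..1}"
  shows "\<bar>integral {0..s} d - integral {0..t} d\<bar> \<le> K * \<bar>s - t\<bar>"
  using s t
proof (induction s t rule: linorder_wlog)
  case (le s t)
  have "d integrable_on {0..t}" "d integrable_on {s..t}"
    using le by (auto intro!: integrable_on_subinterval[OF int])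
  then have "integral {0..t} d - integral {0..s} d = integral {s..t} d"
    using Henstock_Kurzweil_Integration.integral_combine[of 0 s t d] le by simp
  moreover have "norm (integral {s..t} d) \<le> K * measure lborel {s..t}"
  proof (rule has_integral_bound_real[where S = "{}"])
    show "0 \<le> K" using bound[of 0] by simp
  qed (use bound le \<open>d integrable_on {s..t}\<close> in \<open>auto intro: integrable_integral\<close>)
  ultimately show ?case using le by (simp add: abs_minus_commute)
qed (simp add: abs_minus_commute)

section \<open>The boundary value problem\<close>

theorem corollary1p2:
  fixes u :: "real \<Rightarrow> real" and \<beta> \<eta> :: real
    and f g :: "real \<Rightarrow> real \<Rightarrow> real"
  assumes u: "u \<in> G01"
    and eta: "\<eta> \<in> {0..1}"
    and H1: "\<forall>x\<in>G01. (\<lambda>t. f t (x t)) integrable_on {0..1}"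
    and H2: "\<forall>t\<in>{0..1}. continuous_on UNIV (f t)"
    and H3': "\<exists>h :: real \<Rightarrow> real. (\<forall>t\<in>{0..1}. 0 \<le> h t) \<and> h integrable_on {0..1} \<and>
                (\<forall>r>0. \<forall>x\<in>G01_ball r. \<forall>t\<in>{0..1}. - h t \<le> f t (x t) \<and> f t (x t) \<le> h t)"
    and H4: "\<forall>x\<in>G01. has_bounded_variation 0 1 (\<lambda>t. g t (x t)) \<and> g 0 (x 0) = 0"
    and H5: "\<forall>t\<in>{0..1}. continuous_on UNIV (g t)"
    and H6: "\<exists>M>0. \<forall>r>0. \<forall>x\<in>G01_ball r. total_variation 0 1 (\<lambda>t. g t (x t)) \<le> ennreal M"
  shows "\<exists>x. is_BVP_solution f g u \<beta> \<eta> x"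
proof -

  \<comment> \<open>Uniform bounds for both nonlinear terms\<close>
  obtain h where h0: "\<forall>t\<in>{0..1}. 0 \<le> h t" and h_int: "h integrable_on {0..1}"
    and "\<forall>r>0. \<forall>x\<in>G01_ball r. \<forall>t\<in>{0..1}. - h t \<le> f t (x t) \<and> f t (x t) \<le> h t"
    using H3' by blast
  then have "- h t \<le> f t (x t) \<and> f t (x t) \<le> h t" if "x \<in> G01" "t \<in> {0..1}" for x t
    using G01_in_some_ball[OF that(1)] that(2) by blast
  then have f_le: "\<bar>f t (x t)\<bar> \<le> h t" if "x \<in> G01" "t \<in> {0..1}" for x t
    using that by (simp add: abs_le_iff minus_le_iff)
  obtain M where M: "0 < M"
    and "\<forall>r>0. \<forall>x\<in>G01_ball r. total_variation 0 1 (\<lambda>t. g t (x t)) \<le> ennreal M"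
    using H6 by blast
  then have gBV: "(\<lambda>t. g t (x t)) \<in> normalized_BV M" if "x \<in> G01" for x
    using G01_in_some_ball[OF that] H4 that unfolding normalized_BV_def by blast
  obtain J B where "\<forall>v\<in>normalized_BV M. J v \<in> G01 \<and>
             (\<forall>t\<in>{0..1}. has_KHS_integral v u 0 t (J v t) \<and> \<bar>J v t\<bar> \<le> B)"
    and J_cont: "\<forall>V :: nat \<Rightarrow> real \<Rightarrow> real. \<forall>v\<in>normalized_BV M.
             (\<forall>n. V n \<in> normalized_BV M) \<and> (\<forall>\<tau>\<in>{0..1}. (\<lambda>n. V n \<tau>) \<longlonglongrightarrow> v \<tau>) \<longrightarrow>
             (\<forall>t\<in>{0..1}. (\<lambda>n. J (V n) t) \<longlonglongrightarrow> J v t)"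
    using regulated_KHS_operator[OF u less_imp_le[OF M]] by blast
  then have J: "has_KHS_integral v u 0 t (J v t)" "J v \<in> G01" "\<bar>J v t\<bar> \<le> B"
    if "v \<in> normalized_BV M" "t \<in> {0..1}" for v t
    using that by blast+

  \<comment> \<open>The operator \<open>T\<close> and its bounds\<close>
  define F where "F x t = integral {0..t} (\<lambda>s. f s (x s))" for x t
  define G where "G x = J (\<lambda>t. g t (x t))" for x
  define p where "p x t = F x t + G x t" for x t
  define c where "c x = (p x 1 + p x \<eta>) / 2" for x
  define D where "D x t = c x - p x t" for x t
  define T where "T x t = \<beta> * c x + integral {0..t} (D x)" for x t
  \<comment> \<open>A common bound for \<open>p\<close> and \<open>c\<close>, hence
    \<open>2 * A\<close> for \<open>D\<close>; the summand 1 makes it positive even if both terms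
    vanish.\<close>
  define A where "A = integral {0..1} h + \<bar>B\<bar> + 1"
  have f_int: "(\<lambda>s. f s (x s)) integrable_on {0..t}" if "x \<in> G01" "t \<in> {0..1}" for x t
    using H1 that by (auto intro: integrable_on_subinterval)
  have h_int_sub: "h integrable_on {0..t}" if "t \<in> {0..1}" for t
    using h_int that by (auto intro: integrable_on_subinterval)
  have "\<bar>F x t\<bar> \<le> integral {0..1} h" if x: "x \<in> G01" and t: "t \<in> {0..1}" for x t
  proof -
    have "norm (F x t) \<le> integral {0..t} h"
      unfolding F_def by (rule integral_norm_bound_integral[OF f_int[OF that] h_int_sub[OF t]]) (use f_le x t in auto)
    also have "\<dots> \<le> integral {0..1} h"
      using t h0 by (intro integral_subset_le h_int_sub) auto
    finally show ?thesis by simp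
  qed
  moreover have "\<bar>G x t\<bar> \<le> \<bar>B\<bar>" if "x \<in> G01" "t \<in> {0..1}" for x t
    using J(3)[OF gBV[OF that(1)] that(2)] unfolding G_def by linarith
  ultimately have p_le: "\<bar>p x t\<bar> \<le> A" if "x \<in> G01" "t \<in> {0..1}" for x t
    using that unfolding p_def A_def by (smt (verit))
  have A: "0 < A"
  proof -
    have "0 \<le> integral {0..1} h" using h0 by (intro integral_nonneg h_int) auto
    then show ?thesis unfolding A_def by linarith
  qed
  have c_le: "\<bar>c x\<bar> \<le> A" if "x \<in> G01" for x
    using p_le[OF that, of 1] p_le[OF that eta] unfolding c_def by auto
  have D_le: "\<bar>D x t\<bar> \<le> 2 * A" if "x \<in> G01" "t \<in> {0..1}" for x t
    using p_le[OF that] c_le[OF that(1)] unfolding D_def by linarith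
  have D_G01: "D x \<in> G01" if "x \<in> G01" for x
  proof -
    have "F x \<in> G01"
      unfolding F_def using H1 that by (intro G01_continuous indefinite_integral_continuous_1) auto
    \<comment> \<open>The index 0 only discharges the premise on \<open>t\<close> in the bundled
      fact; regularity of \<open>J v\<close> does not depend on it.\<close>
    then have "p x \<in> G01" unfolding p_def G_def using J(2)[OF gBV[OF that], of 0] by (intro G01_add) auto
    then show ?thesis unfolding D_def by (rule G01_diff[OF G01_const])
  qed
  have D_int: "D x integrable_on {0..t}" if "x \<in> G01" "t \<in> {0..1}" for x t
    using regulated_integrable[OF D_G01[OF that(1)]] that(2) by simp

  \<comment> \<open>Existence of a fixed point of \<open>T\<close>\<close>
  have "\<exists>x\<in>G01. \<forall>t\<in>{0..1}. T x t = x t"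
  proof (rule fixpoint_G01)
    fix x and s t :: real assume x: "x \<in> G01" and s: "s \<in> {0..1}" and t: "t \<in> {0..1}"
    \<comment> \<open>Stated for every \<open>s\<close>, because \<open>s = 0\<close>, where the
      integral vanishes, also gives the bound on its size.\<close>
    have lip: "\<bar>integral {0..s} (D x) - integral {0..t} (D x)\<bar> \<le> 2 * A * \<bar>s - t\<bar>" if "s \<in> {0..1}" for s
      by (rule indefinite_integral_bounded_lipschitz[OF D_int[OF x] D_le[OF x] that t]) auto
    then show "\<bar>T x s - T x t\<bar> \<le> 2 * A * \<bar>s - t\<bar>" using s unfolding T_def by simp
    have "\<bar>integral {0..t} (D x)\<bar> \<le> 2 * A * t" using lip[of 0] t by simp
    also have "\<dots> \<le> 2 * A" using A t by simp
    finally have "\<bar>integral {0..t} (D x)\<bar> \<le> 2 * A" .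
    moreover have "\<bar>\<beta> * c x\<bar> \<le> \<bar>\<beta>\<bar> * A" using c_le[OF x] by (simp add: abs_mult mult_left_mono)
    ultimately show "\<bar>T x t\<bar> \<le> \<bar>\<beta>\<bar> * A + 2 * A" unfolding T_def by linarith
  next
    fix X :: "nat \<Rightarrow> real \<Rightarrow> real" and x and t :: real
    assume X: "\<And>n. X n \<in> G01" and x: "x \<in> G01" and t: "t \<in> {0..1}"
      and lim: "\<And>\<tau>. \<tau> \<in> {0..1} \<Longrightarrow> (\<lambda>n. X n \<tau>) \<longlonglongrightarrow> x \<tau>"
    have f_lim: "(\<lambda>n. f \<tau> (X n \<tau>)) \<longlonglongrightarrow> f \<tau> (x \<tau>)" if "\<tau> \<in> {0..1}" for \<tau>
      using H2 that by (intro continuous_on_tendsto_compose[OF _ lim]) auto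
    have g_lim: "(\<lambda>n. g \<tau> (X n \<tau>)) \<longlonglongrightarrow> g \<tau> (x \<tau>)" if "\<tau> \<in> {0..1}" for \<tau>
      using H5 that by (intro continuous_on_tendsto_compose[OF _ lim]) auto
    have "(\<lambda>n. F (X n) \<tau>) \<longlonglongrightarrow> F x \<tau>" if \<tau>: "\<tau> \<in> {0..1}" for \<tau>
      unfolding F_def
      by (rule dominated_convergence(2)[OF f_int[OF X \<tau>] h_int_sub[OF \<tau>]]) (use f_le[OF X] f_lim \<tau> in auto)
    moreover have "(\<lambda>n. G (X n) \<tau>) \<longlonglongrightarrow> G x \<tau>" if \<tau>: "\<tau> \<in> {0..1}" for \<tau>
      unfolding G_def
      by (rule J_cont[THEN spec[of _ "\<lambda>n t. g t (X n t)"], rule_format, OF gBV[OF x] _ \<tau>])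
        (use gBV[OF X] g_lim in blast)
    ultimately have p_lim: "(\<lambda>n. p (X n) \<tau>) \<longlonglongrightarrow> p x \<tau>" if "\<tau> \<in> {0..1}" for \<tau>
      unfolding p_def using that by (intro tendsto_add) auto
    then have c_lim: "(\<lambda>n. c (X n)) \<longlonglongrightarrow> c x"
      unfolding c_def using eta by (intro tendsto_intros) auto
    have D_lim: "(\<lambda>n. D (X n) \<tau>) \<longlonglongrightarrow> D x \<tau>" if "\<tau> \<in> {0..1}" for \<tau>
      unfolding D_def by (intro tendsto_diff c_lim p_lim that)
    have "(\<lambda>n. integral {0..t} (D (X n))) \<longlonglongrightarrow> integral {0..t} (D x)"
      by (rule dominated_convergence(2)[OF D_int[OF X t], of "\<lambda>_. 2 * A"]) (use D_le[OF X] D_lim t in auto)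
    then show "(\<lambda>n. T (X n) t) \<longlonglongrightarrow> T x t"
      unfolding T_def by (intro tendsto_add tendsto_mult tendsto_const c_lim)
  qed (use A in \<open>auto intro: add_nonneg_pos\<close>)

  \<comment> \<open>The fixed point solves the boundary value problem\<close>
  then obtain x where x: "x \<in> G01" and fixed: "\<And>t. t \<in> {0..1} \<Longrightarrow> x t = T x t" by metis
  have "G x 0 = 0"
    unfolding G_def by (rule has_KHS_integral_point[OF J(1)[OF gBV[OF x]]]) simp
  \<comment> \<open>Since \<open>p\<close> vanishes at 0, the constant \<open>c x\<close> is the
    initial value of \<open>D x\<close>, which gives \<open>\<beta> * c x\<close> in
    \<open>T\<close> its meaning as the first boundary condition.\<close>
  then have p0: "p x 0 = 0" by (simp add: p_def F_def)
  then have D0: "D x 0 = c x" by (simp add: D_def)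
  show ?thesis
    unfolding is_BVP_solution_def
  proof (intro exI conjI bexI[of _ "D x"])
    show "\<forall>t\<in>{0..1}. ((\<lambda>s. f s (x s)) has_integral F x t) {0..t}"
      unfolding F_def using integrable_integral[OF f_int[OF x]] by blast
    show "\<forall>t\<in>{0..1}. has_KHS_integral (\<lambda>s. g s (x s)) u 0 t (G x t)"
      unfolding G_def using J(1)[OF gBV[OF x]] by blast
    show "\<forall>t\<in>{0..1}. x t = x 0 + integral {0..t} (D x)"
      using fixed by (simp add: T_def)
    show "\<forall>t\<in>{0..1}. D x t = D x 0 - F x t - G x t"
      by (simp add: D0) (simp add: D_def p_def)
    show "x 0 = \<beta> * D x 0" using fixed[of 0] by (simp add: T_def D0)
    show "D x 1 + D x \<eta> = 0" by (simp add: D_def c_def field_simps)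
  qed (fact x D_G01[OF x])+
qed

end
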